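(* Let $\mathcal{S}_{\mathcal{G}}'\subseteq\mathcal{V}_{\mathcal{G}}$ with $|\mathcal{S}_{\mathcal{G}}'|=B_{\mathcal{G}}$ and $\operatorname{rank}(\mathbf{U}_{\mathcal{G}}(\mathcal{S}_{\mathcal{G}}',\mathcal{I}))=B_{\mathcal{G}}$. Let $\mathcal{S}\subseteq\mathcal{S}_{\mathcal{G}}'\times\mathbb{Z}$ be a stable sampling set for the signals $\mathbf{X}(\mathcal{S}_{\mathcal{G}}',\cdot)$, $\mathbf{X}\in\mathcal{BL}_D(\{\mathcal{F}_1,\dots,\mathcal{F}_{B_{\mathcal{G}}}\})$, of joint bandwidth $B$. For $\Theta\subseteq\mathcal{S}_{\mathcal{G}}'$ let $\mathcal{S}_\Theta=\{(v,n)\in\mathcal{S}:v\in\Theta\}$ and $\Theta^c=\mathcal{S}_{\mathcal{G}}'\setminus\Theta$. Then $$R_D(\mathcal{S}_\Theta)\ \ge\ \frac{1}{|\Theta|}\left(B-\int_{\mathcal{F}}\operatorname{rank}\big(\mathbf{U}_{\mathcal{G}}(\Theta^c,\mathcal{I}_f)\big)\,df\right).$$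
   Context: $\mathcal{G}$ undirected graph with vertex set $\mathcal{V}_{\mathcal{G}}$, $|\mathcal{V}_{\mathcal{G}}|=N$, orthonormal Laplacian eigenvector matrix $\mathbf{U}_{\mathcal{G}}$ (columns $\mathbf{u}_i$), $\mathbf{U}_{\mathcal{G}}(A,C)$ the submatrix with rows $A$ and columns $C$. A discrete time-vertex graph signal (DTVGS) is $\mathbf{X}=(\mathbf{X}(v,\cdot))_{v}$ with $\mathbf{X}(v,\cdot)\in\ell^2(\mathbb{Z})$. Its JFT, in normalized frequency $f\in[-\tfrac12,\tfrac12)$ (one period of the DTFT), is $\mathcal{F}_{\mathcal{J}}(\mathbf{X})(i,f)=\sum_v\mathbf{u}_i(v)\sum_{n\in\mathbb{Z}}\mathbf{X}(v,n)e^{-j2\pi fn}$. $\mathcal{F}_i\subseteq[-\tfrac12,\tfrac12)$ is the support of $\mathcal{F}_{\mathcal{J}}(\mathbf{X})(i,\cdot)$ in one period (finite union of intervals), $\mathcal{I}_f=\{i:f\in\mathcal{F}_i\}$, $\mathcal{F}=\bigcup\mathcal{F}_i$, $\mathcal{I}=\bigcup_f\mathcal{I}_f$, $B_{\mathcal{G}}=|\mathcal{I}|$, joint bandwidth $B=\sum_i\mu(\mathcal{F}_i)$. $\mathcal{BL}_D(\{\mathcal{F}_1,\dots,\mathcal{F}_{B_{\mathcal{G}}}\})$ is the space of DTVGS whose JFT vanishes for $f\notin\mathcal{F}_i$ (arbitrary values on $\mathcal{F}_i$). A sampling set $\mathcal{S}$ of pairs $(v,n)$ is stable if $A\|\mathbf{X}\|^2\le\sum_{(v,n)\in\mathcal{S}}|\mathbf{X}(v,n)|^2\le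 A'\|\mathbf{X}\|^2$ for constants $0<A\le A'<\infty$ and all signals in the class. Sampling ratios: $R_D(\mathcal{S}_v)=\liminf_{n\to\infty}|\mathcal{S}_v\cap[-n,n]|/(2n)$; $R_D(\mathcal{S}_\Theta)=\liminf_{n\to\infty}|\mathcal{S}_\Theta\cap(\Theta\times[-n,n])|/(2n|\Theta|)$; total ratio $R_D(\mathcal{S})=\liminf_{n\to\infty}|\mathcal{S}\cap(\mathcal{V}_{\mathcal{G}}\times[-n,n])|/(2nN)$. *)

theory Defs
  imports "HOL-Analysis.Analysis"
begin

definition laplacian :: "real^'v^'v \<Rightarrow> real^'v^'v" where
  "laplacian W = (\<chi> u v. (if u = v then (\<Sum>w\<in>UNIV. W $ u $ w) else 0) - W $ u $ v)"

definition undirected_graph_weights :: "real^'v^'v \<Rightarrow> bool" where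
  "undirected_graph_weights W \<longleftrightarrow>
     (\<forall>u v. W $ u $ v = W $ v $ u) \<and> (\<forall>u v. 0 \<le> W $ u $ v) \<and> (\<forall>u. W $ u $ u = 0)"

definition laplacian_eigvec_matrix :: "real^'v^'v \<Rightarrow> real^'i^'v \<Rightarrow> bool" where
  "laplacian_eigvec_matrix W U \<longleftrightarrow>
     CARD('i) = CARD('v) \<and> transpose U ** U = mat 1 \<and>
     (\<forall>i. \<exists>c. laplacian W *v column i U = c *\<^sub>R column i U)"

text \<open>Rank of the submatrix U(A,C) with rows A and columns C (computed as the rank
  of U with all entries outside A x C set to zero).\<close>
definition subrank :: "real^'i^'v \<Rightarrow> 'v set \<Rightarrow> 'i set \<Rightarrow> nat" where
  "subrank U A C = rank (\<chi> v i. if v \<in> A \<and> i \<in> C then U $ v $ i else 0)"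

text \<open>Y is the DTFT (on one period [-1/2,1/2)) of the sequence y in l2(Z):
  Y is square-integrable and y are its Fourier coefficients,
  y n = int_{-1/2}^{1/2} Y(f) e^{j 2 pi f n} df.\<close>
definition dtft_is :: "(int \<Rightarrow> complex) \<Rightarrow> (real \<Rightarrow> complex) \<Rightarrow> bool" where
  "dtft_is y Y \<longleftrightarrow>
     Y measurable_on {-1/2..1/2} \<and>
     (\<lambda>f. (cmod (Y f))^2) integrable_on {-1/2..1/2} \<and>
     (\<forall>n. y n = integral {-1/2..1/2} (\<lambda>f. Y f * cis (2 * pi * f * real_of_int n)))"

definition finite_union_of_intervals :: "real set \<Rightarrow> bool" where
  "finite_union_of_intervals A \<longleftrightarrow>
     (\<exists>\<C>. finite \<C> \<and> (\<forall>C\<in>\<C>. is_interval C) \<and> A = \<Union>\<C>)"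

definition dtvgs :: "('v \<Rightarrow> int \<Rightarrow> complex) \<Rightarrow> bool" where
  "dtvgs X \<longleftrightarrow> (\<forall>v. (\<lambda>n. (cmod (X v n))^2) summable_on UNIV)"

text \<open>The band-limited class BL_D({F_i}): the JFT row i, i.e. the DTFT of
  n \<mapsto> sum_v u_i(v) X(v,n), vanishes for f \<in> [-1/2,1/2) outside F_i.\<close>
definition BL_D :: "real^'i^'v \<Rightarrow> ('i \<Rightarrow> real set) \<Rightarrow> ('v \<Rightarrow> int \<Rightarrow> complex) set" where
  "BL_D U F = {X. dtvgs X \<and>
     (\<forall>i. \<exists>Y. dtft_is (\<lambda>n. \<Sum>v\<in>UNIV. complex_of_real (U $ v $ i) * X v n) Y \<and>
              (\<forall>f\<in>{-1/2..<1/2} - F i. Y f = 0))}"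

definition sq_norm_on :: "'v set \<Rightarrow> ('v \<Rightarrow> int \<Rightarrow> complex) \<Rightarrow> real" where
  "sq_norm_on V X = (\<Sum>v\<in>V. \<Sum>\<^sub>\<infinity>n. (cmod (X v n))^2)"

definition sample_energy :: "('v \<times> int) set \<Rightarrow> ('v \<Rightarrow> int \<Rightarrow> complex) \<Rightarrow> real" where
  "sample_energy S X = (\<Sum>\<^sub>\<infinity>(v,n)\<in>S. (cmod (X v n))^2)"

definition stable_sampling :: "('v \<times> int) set \<Rightarrow> 'v set \<Rightarrow> ('v \<Rightarrow> int \<Rightarrow> complex) set \<Rightarrow> bool" where
  "stable_sampling S V C \<longleftrightarrow>
     (\<exists>A A'. 0 < A \<and> A \<le> A' \<and>
        (\<forall>X\<in>C. A * sq_norm_on V X \<le> sample_energy S X \<and> sample_energy S X \<le> A' * sq_norm_on V X))"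

definition sampling_ratio :: "('v \<times> int) set \<Rightarrow> 'v set \<Rightarrow> ereal" where
  "sampling_ratio S\<Theta> \<Theta> = liminf (\<lambda>n::nat. ereal (real (card (S\<Theta> \<inter> (\<Theta> \<times> {-int n..int n})))
        / (2 * real n * real (card \<Theta>))))"

end

theory Submission
  imports Defs
begin

text \<open>A signal of the class that vanishes on the rows outside \<open>\<Theta>\<close> is sampled stably by the samples in
  \<open>\<Theta>\<close> alone. At frequency \<open>f\<close> its spectral vector ranges over the kernel of
  \<open>U(\<Theta>\<^sup>c, I\<^sub>f)\<close>, of dimension \<open>card I\<^sub>f - rank U(\<Theta>\<^sup>c, I\<^sub>f)\<close>, so the claim is a
  density theorem of Landau type for this shift-invariant space. Such a space has about
  \<open>2N \<integral> dim\<close> degrees of freedom in the window \<open>[-N, N]\<close>, measured by the trace of the compression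
  \<open>P\<close> of its projection to the window. Stability bounds \<open>P\<close>, up to a constant, by the Gram operator of the
  samples; the part of that operator coming from samples in \<open>[-N - R, N + R]\<close> has rank at most their
  number, and the rest has trace \<open>o(1)\<cdot>N\<close> as \<open>R\<close> grows because the kernels are square summable. Since
  \<open>0 \<le> P \<le> 1\<close>, the trace of \<open>P\<close> is at most that rank plus the remainder.\<close>

subsection \<open>A trace estimate\<close>

text \<open>The obstacle is that the kernel varies with the frequency. Only finitely many active
  sets occur, so the period splits into finitely many measurable pieces on which the kernel is
  constant. An orthonormal basis of the kernel on each piece turns the space into a finite
  orthogonal sum of scalar spaces, each band-limited to its piece, and the density argument runs on
  these channels, mixed by a fixed matrix \<open>M\<close>. The constant in the comparison with the
  Gram operator is \<open>1 / (\<delta> * a)\<close>: \<open>a\<close> is the lower stability bound,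
  and \<open>\<delta>\<close> comes from the full rank on \<open>S'G\<close>, which lets the energy
  on \<open>S'G\<close> control the energy of the whole spectrum. No operator is formed. Traces are
  sums of energies over a finite family of shifted kernels, and the rank bound becomes an induction
  on the samples. Since only finite combinations are tested, every test spectrum is built from
  indicators and trigonometric polynomials, so bounded functions suffice. The window grows while the
  margin \<open>R\<close> is fixed; only afterwards does \<open>R\<close> grow.\<close>

lemma sum_projection_square:
  fixes z u :: "'a \<Rightarrow> complex"
  assumes "(\<Sum>a\<in>J. (cmod (u a))\<^sup>2) = 1"
  shows "(\<Sum>a\<in>J. (cmod (z a - cnj (u a) * (\<Sum>b\<in>J. u b * z b)))\<^sup>2)
    = (\<Sum>a\<in>J. (cmod (z a))\<^sup>2) - (cmod (\<Sum>b\<in>J. u b * z b))\<^sup>2"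
proof -
  \<comment> \<open>Pythagoras: \<open>y\<close> is the coefficient of \<open>z\<close> along the
    unit vector \<open>cnj u\<close>.\<close>
  define y where "y = (\<Sum>b\<in>J. u b * z b)"
  have u1: "(\<Sum>a\<in>J. u a * cnj (u a)) = 1"
    using arg_cong[OF assms, of complex_of_real] by (simp only: of_real_sum complex_norm_square of_real_1)
  have "complex_of_real (\<Sum>a\<in>J. (cmod (z a - cnj (u a) * y))\<^sup>2)
      = (\<Sum>a\<in>J. (z a - cnj (u a) * y) * cnj (z a - cnj (u a) * y))"
    by (simp only: of_real_sum complex_norm_square)
  also have "\<dots> = (\<Sum>a\<in>J. z a * cnj (z a)) - (\<Sum>a\<in>J. u a * z a) * cnj y
      - y * cnj (\<Sum>a\<in>J. u a * z a) + (\<Sum>a\<in>J. u a * cnj (u a)) * (y * cnj y)"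
    by (simp add: algebra_simps sum.distrib sum_subtractf sum_distrib_left sum_distrib_right)
  also have "\<dots> = (\<Sum>a\<in>J. z a * cnj (z a)) - y * cnj y"
    by (simp add: u1 y_def[symmetric])
  also have "\<dots> = complex_of_real ((\<Sum>a\<in>J. (cmod (z a))\<^sup>2) - (cmod y)\<^sup>2)"
    by (simp only: of_real_sum of_real_diff complex_norm_square)
  finally show ?thesis unfolding y_def of_real_eq_iff .
qed

section \<open>Finite sums of square-summable families\<close>

lemma has_sum_finite_sum:
  fixes f :: "'a \<Rightarrow> 's \<Rightarrow> 'b::topological_comm_monoid_add"
  assumes "\<And>a. a \<in> J \<Longrightarrow> (f a has_sum g a) T"
  shows "((\<lambda>t. \<Sum>a\<in>J. f a t) has_sum (\<Sum>a\<in>J. g a)) T"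
proof (cases "finite J")
  case True
  then show ?thesis using assms by (induction J) (auto intro: has_sum_add)
qed simp

lemma infsum_finite_sum:
  fixes f :: "'a \<Rightarrow> 's \<Rightarrow> 'b::{topological_comm_monoid_add, t2_space}"
  assumes "\<And>a. a \<in> J \<Longrightarrow> f a summable_on T"
  shows "(\<Sum>\<^sub>\<infinity>t\<in>T. \<Sum>a\<in>J. f a t) = (\<Sum>a\<in>J. \<Sum>\<^sub>\<infinity>t\<in>T. f a t)"
    and "(\<lambda>t. \<Sum>a\<in>J. f a t) summable_on T"
  using has_sum_finite_sum[where f = f and g = "\<lambda>a. infsum (f a) T" and T = T and J = J] assms
  by (auto simp: infsumI summable_on_def)

lemma summable_on_square_cmult:
  fixes f :: "'s \<Rightarrow> complex"
  assumes "(\<lambda>s. (cmod (f s))\<^sup>2) summable_on D"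
  shows "(\<lambda>s. (cmod (c * f s))\<^sup>2) summable_on D"
  using summable_on_cmult_right[OF assms, of "(cmod c)\<^sup>2"] by (simp add: norm_mult power_mult_distrib)

lemma cmod_add_square_le: "(cmod (a + b))\<^sup>2 \<le> 2 * (cmod a)\<^sup>2 + 2 * (cmod b)\<^sup>2"
proof -
  have "(cmod (a + b))\<^sup>2 \<le> (cmod a + cmod b)\<^sup>2"
    by (intro power_mono norm_triangle_ineq) auto
  also have "\<dots> \<le> 2 * (cmod a)\<^sup>2 + 2 * (cmod b)\<^sup>2"
    using sum_squares_bound[of "cmod a" "cmod b"] by (simp add: power2_sum)
  finally show ?thesis .
qed

lemma summable_on_square_add:
  fixes f g :: "'s \<Rightarrow> complex"
  assumes "(\<lambda>s. (cmod (f s))\<^sup>2) summable_on D" "(\<lambda>s. (cmod (g s))\<^sup>2) summable_on D"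
  shows "(\<lambda>s. (cmod (f s + g s))\<^sup>2) summable_on D"
proof (rule summable_on_comparison_test)
  show "(\<lambda>s. 2 * (cmod (f s))\<^sup>2 + 2 * (cmod (g s))\<^sup>2) summable_on D"
    by (intro summable_on_add summable_on_cmult_right assms)
  fix s
  show "(cmod (f s + g s))\<^sup>2 \<le> 2 * (cmod (f s))\<^sup>2 + 2 * (cmod (g s))\<^sup>2"
    by (rule cmod_add_square_le)
qed auto

lemma summable_on_square_sum:
  fixes f :: "'a \<Rightarrow> 's \<Rightarrow> complex"
  assumes "\<And>a. a \<in> J \<Longrightarrow> (\<lambda>s. (cmod (f a s))\<^sup>2) summable_on D"
  shows "(\<lambda>s. (cmod (\<Sum>a\<in>J. c a * f a s))\<^sup>2) summable_on D"
proof (cases "finite J")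
  case True
  then show ?thesis using assms
    by (induction J) (simp_all add: summable_on_square_add summable_on_square_cmult)
qed simp

text \<open>The Gram operator of the \<^term>\<open>x\<close>-family is at most one, and outside the
  at most \<^term>\<open>card S\<close> dimensions seen by the samples in \<^term>\<open>S\<close> it is dominated by the energy
  on \<^term>\<open>D\<close>. The induction removes one sample at a time by projecting it away.\<close>

lemma sum_energy_le_card:
  fixes x :: "'a \<Rightarrow> 'c \<Rightarrow> complex" and y :: "'a \<Rightarrow> 's \<Rightarrow> complex"
  assumes "finite S" and "finite J" and "0 \<le> \<alpha>"
    and "\<And>a. a \<in> J \<Longrightarrow> (\<lambda>w. (cmod (x a w))\<^sup>2) summable_on C"
    and "\<And>a. a \<in> J \<Longrightarrow> (\<lambda>s. (cmod (y a s))\<^sup>2) summable_on D"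
    and "\<And>c. (\<Sum>\<^sub>\<infinity>w\<in>C. (cmod (\<Sum>a\<in>J. c a * x a w))\<^sup>2) \<le> (\<Sum>a\<in>J. (cmod (c a))\<^sup>2)"
    and "\<And>c. (\<Sum>\<^sub>\<infinity>w\<in>C. (cmod (\<Sum>a\<in>J. c a * x a w))\<^sup>2)
        \<le> \<alpha> * ((\<Sum>s\<in>S. (cmod (\<Sum>a\<in>J. c a * y a s))\<^sup>2) + (\<Sum>\<^sub>\<infinity>s\<in>D. (cmod (\<Sum>a\<in>J. c a * y a s))\<^sup>2))"
  shows "(\<Sum>a\<in>J. \<Sum>\<^sub>\<infinity>w\<in>C. (cmod (x a w))\<^sup>2)
    \<le> real (card S) + \<alpha> * (\<Sum>a\<in>J. \<Sum>\<^sub>\<infinity>s\<in>D. (cmod (y a s))\<^sup>2)"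
  using assms(1,4-)
proof (induction S arbitrary: x y rule: finite_induct)
  case empty
  \<comment> \<open>Without samples, testing the domination on a coordinate vector bounds each term
    separately.\<close>
  have "(\<Sum>\<^sub>\<infinity>w\<in>C. (cmod (x a w))\<^sup>2) \<le> \<alpha> * (\<Sum>\<^sub>\<infinity>s\<in>D. (cmod (y a s))\<^sup>2)" if "a \<in> J" for a
  proof -
    have *: "(\<Sum>b\<in>J. (if b = a then 1 else 0) * h b) = h a" for h :: "'a \<Rightarrow> complex"
      using that \<open>finite J\<close> by (simp add: if_distrib[of "\<lambda>t. t * _"] cong: if_cong)
    show ?thesis using empty(4)[of "\<lambda>b. if b = a then 1 else 0"] by (simp add: *)
  qed
  then show ?case by (simp add: sum_distrib_left sum_mono)
next
  case (insert s S)
  show ?case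
  proof (cases "\<forall>a\<in>J. y a s = 0")
    case True
    have "(\<Sum>a\<in>J. \<Sum>\<^sub>\<infinity>w\<in>C. (cmod (x a w))\<^sup>2)
        \<le> real (card S) + \<alpha> * (\<Sum>a\<in>J. \<Sum>\<^sub>\<infinity>s\<in>D. (cmod (y a s))\<^sup>2)"
      using insert.prems insert.hyps True by (intro insert.IH) (auto simp: algebra_simps)
    then show ?thesis using insert.hyps by simp
  next
    case False
    define r where "r = sqrt (\<Sum>a\<in>J. (cmod (y a s))\<^sup>2)"
    have "(\<Sum>a\<in>J. (cmod (y a s))\<^sup>2) \<noteq> 0"
      using False \<open>finite J\<close> by (subst sum_nonneg_eq_0_iff) auto
    then have "(\<Sum>a\<in>J. (cmod (y a s))\<^sup>2) > 0"
      by (simp add: order_less_le sum_nonneg)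
    then have r: "r > 0" and r2: "r\<^sup>2 = (\<Sum>a\<in>J. (cmod (y a s))\<^sup>2)"
      by (simp_all add: r_def)
    \<comment> \<open>The row of \<open>y\<close> at the sample \<open>s\<close> is \<open>r\<close>
      times \<open>cnj u\<close>. Hence \<open>pr\<close>, which removes the component along
      \<open>cnj u\<close>, makes the new family invisible at \<open>s\<close>.\<close>
    define u where "u a = cnj (y a s) / r" for a
    have u1: "(\<Sum>a\<in>J. (cmod (u a))\<^sup>2) = 1"
      using r by (simp add: u_def norm_divide power_divide r2[symmetric] flip: sum_divide_distrib)
    define pr where "pr h = (\<lambda>a. h a - cnj (u a) * (\<Sum>b\<in>J. u b * h b))" for h :: "'a \<Rightarrow> complex"
    define x' where "x' a w = pr (\<lambda>b. x b w) a" for a w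
    define y' where "y' a t = pr (\<lambda>b. y b t) a" for a t
    \<comment> \<open>The transpose of \<open>pr\<close>: a combination of the projected family is a
      combination of the old family with coefficients \<open>cc c\<close>, which are no longer than
      \<open>c\<close>. Both hypotheses therefore pass to the projected family.\<close>
    define cc where "cc c a = c a - u a * (\<Sum>b\<in>J. c b * cnj (u b))" for c a
    have pr_sum: "(\<Sum>a\<in>J. c a * pr h a) = (\<Sum>a\<in>J. cc c a * h a)" for c h
      by (simp add: pr_def cc_def algebra_simps sum_subtractf sum_distrib_left sum_distrib_right)
         (subst sum.swap, simp add: mult_ac)
    have cc_le: "(\<Sum>a\<in>J. (cmod (cc c a))\<^sup>2) \<le> (\<Sum>a\<in>J. (cmod (c a))\<^sup>2)" for c
      using sum_projection_square[of "\<lambda>a. cnj (u a)" J c] u1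
      by (simp add: cc_def mult.commute)
    have pr_sq: "(\<Sum>a\<in>J. (cmod (pr h a))\<^sup>2) = (\<Sum>a\<in>J. (cmod (h a))\<^sup>2) - (cmod (\<Sum>b\<in>J. u b * h b))\<^sup>2"
      for h using sum_projection_square[OF u1, of h] by (simp add: pr_def)
    have y's: "y' a s = 0" for a
    proof -
      have "(\<Sum>b\<in>J. u b * y b s) = complex_of_real (r\<^sup>2) / r"
        unfolding r2 of_real_sum complex_norm_square u_def
        by (simp add: sum_divide_distrib mult.commute)
      also have "\<dots> = r" using r by (simp add: power2_eq_square)
      finally show ?thesis using r by (simp add: y'_def pr_def u_def)
    qed
    have pr_l2: "(\<lambda>t. (cmod (pr (\<lambda>b. z b t) a))\<^sup>2) summable_on T"
      if "\<And>a. a \<in> J \<Longrightarrow> (\<lambda>t. (cmod (z a t))\<^sup>2) summable_on T" "a \<in> J"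
      for z a and T :: "'e set"
      unfolding pr_def diff_conv_add_uminus mult_minus_left[symmetric]
      by (intro summable_on_square_add summable_on_square_cmult summable_on_square_sum that)
    have pr_l2_sum: "(\<Sum>a\<in>J. \<Sum>\<^sub>\<infinity>t\<in>T. (cmod (pr (\<lambda>b. z b t) a))\<^sup>2)
        = (\<Sum>a\<in>J. \<Sum>\<^sub>\<infinity>t\<in>T. (cmod (z a t))\<^sup>2) - (\<Sum>\<^sub>\<infinity>t\<in>T. (cmod (\<Sum>b\<in>J. u b * z b t))\<^sup>2)"
      if "\<And>a. a \<in> J \<Longrightarrow> (\<lambda>t. (cmod (z a t))\<^sup>2) summable_on T" for z and T :: "'e set"
    proof -
      have s1: "(\<lambda>t. (cmod (pr (\<lambda>b. z b t) a))\<^sup>2) summable_on T" if "a \<in> J" for a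
        using \<open>\<And>a. a \<in> J \<Longrightarrow> (\<lambda>t. (cmod (z a t))\<^sup>2) summable_on T\<close> that by (rule pr_l2)
      have "(\<Sum>a\<in>J. \<Sum>\<^sub>\<infinity>t\<in>T. (cmod (pr (\<lambda>b. z b t) a))\<^sup>2) + (\<Sum>\<^sub>\<infinity>t\<in>T. (cmod (\<Sum>b\<in>J. u b * z b t))\<^sup>2)
          = (\<Sum>\<^sub>\<infinity>t\<in>T. (\<Sum>a\<in>J. (cmod (pr (\<lambda>b. z b t) a))\<^sup>2) + (cmod (\<Sum>b\<in>J. u b * z b t))\<^sup>2)"
        by (subst infsum_add)
           (auto intro!: summable_on_square_sum infsum_finite_sum infsum_finite_sum(1)[symmetric] s1 that)
      also have "\<dots> = (\<Sum>a\<in>J. \<Sum>\<^sub>\<infinity>t\<in>T. (cmod (z a t))\<^sup>2)"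
        using that by (simp add: pr_sq infsum_finite_sum)
      finally show ?thesis by simp
    qed
    have "(\<Sum>a\<in>J. \<Sum>\<^sub>\<infinity>w\<in>C. (cmod (x' a w))\<^sup>2)
        \<le> real (card S) + \<alpha> * (\<Sum>a\<in>J. \<Sum>\<^sub>\<infinity>s\<in>D. (cmod (y' a s))\<^sup>2)"
    proof (rule insert.IH)
      fix c
      show "(\<Sum>\<^sub>\<infinity>w\<in>C. (cmod (\<Sum>a\<in>J. c a * x' a w))\<^sup>2) \<le> (\<Sum>a\<in>J. (cmod (c a))\<^sup>2)"
        using insert.prems(3)[of "cc c"] cc_le[of c] by (simp add: x'_def pr_sum)
      have "(\<Sum>a\<in>J. cc c a * y a s) = 0"
        using pr_sum[of c "\<lambda>b. y b s"] y's by (simp add: y'_def)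
      then show "(\<Sum>\<^sub>\<infinity>w\<in>C. (cmod (\<Sum>a\<in>J. c a * x' a w))\<^sup>2) \<le> \<alpha> * ((\<Sum>s\<in>S. (cmod (\<Sum>a\<in>J. c a * y' a s))\<^sup>2)
          + (\<Sum>\<^sub>\<infinity>s\<in>D. (cmod (\<Sum>a\<in>J. c a * y' a s))\<^sup>2))"
        using insert.prems(4)[of "cc c"] insert.hyps by (simp add: x'_def y'_def pr_sum)
    qed (auto simp: x'_def y'_def intro!: pr_l2 insert.prems)
    \<comment> \<open>The energy lost by projecting is that of the single combination with
      coefficients \<open>u\<close>, at most 1 because the Gram operator is at most one. This is the
      unit that the sample adds to the cardinality.\<close>
    moreover have "(\<Sum>a\<in>J. \<Sum>\<^sub>\<infinity>w\<in>C. (cmod (x a w))\<^sup>2) \<le> (\<Sum>a\<in>J. \<Sum>\<^sub>\<infinity>w\<in>C. (cmod (x' a w))\<^sup>2) + 1"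
      using pr_l2_sum[of x C, OF insert.prems(1)] insert.prems(3)[of u] u1 by (simp add: x'_def)
    moreover have "\<alpha> * (\<Sum>a\<in>J. \<Sum>\<^sub>\<infinity>s\<in>D. (cmod (y' a s))\<^sup>2) \<le> \<alpha> * (\<Sum>a\<in>J. \<Sum>\<^sub>\<infinity>s\<in>D. (cmod (y a s))\<^sup>2)"
      using pr_l2_sum[of y D, OF insert.prems(2)] \<open>0 \<le> \<alpha>\<close>
      by (intro mult_left_mono) (simp_all add: y'_def infsum_nonneg)
    ultimately show ?thesis using insert.hyps by simp
  qed
qed

subsection \<open>Fourier coefficients on one period\<close>

abbreviation period :: "real measure" where "period \<equiv> lebesgue_on {-1/2..1/2}"

interpretation period: finite_measure period
  by (rule finite_measure_lebesgue_on) auto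

text \<open>The bound is required on the whole line, so the class is closed under products
  pointwise, and the finite measure of the period makes every member integrable and
  square-integrable there.\<close>

definition bounded_measurable :: "(real \<Rightarrow> complex) \<Rightarrow> bool" where
  "bounded_measurable g \<longleftrightarrow> g \<in> borel_measurable period \<and> (\<exists>B. \<forall>f. cmod (g f) \<le> B)"

lemma bounded_measurable_add:
  assumes "bounded_measurable g" "bounded_measurable h"
  shows "bounded_measurable (\<lambda>f. g f + h f)"
  using assms unfolding bounded_measurable_def
  by (auto intro: order_trans[OF norm_triangle_ineq add_mono])

lemma bounded_measurable_mult:
  assumes "bounded_measurable g" "bounded_measurable h"
  shows "bounded_measurable (\<lambda>f. g f * h f)"
proof -
  obtain B B' where "\<And>f. cmod (g f) \<le> B" "\<And>f. cmod (h f) \<le> B'"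
    using assms unfolding bounded_measurable_def by blast
  then have "cmod (g f * h f) \<le> B * B'" for f
    unfolding norm_mult by (intro mult_mono) (auto intro: order_trans[OF norm_ge_zero])
  then show ?thesis using assms unfolding bounded_measurable_def by auto
qed

lemma bounded_measurable_const: "bounded_measurable (\<lambda>f. c)"
  unfolding bounded_measurable_def by auto

lemma bounded_measurable_cnj:
  assumes "bounded_measurable g"
  shows "bounded_measurable (\<lambda>f. cnj (g f))"
proof -
  have "(\<lambda>f. cnj (g f)) \<in> borel_measurable period"
    using assms unfolding bounded_measurable_def
    by (intro borel_measurable_continuous_on[where f=cnj]) (auto intro: continuous_intros)
  then show ?thesis using assms unfolding bounded_measurable_def by auto
qed

lemma bounded_measurable_minus:
  assumes "bounded_measurable g" "bounded_measurable h"
  shows "bounded_measurable (\<lambda>f. g f - h f)"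
  using bounded_measurable_add[OF assms(1) bounded_measurable_mult[OF bounded_measurable_const[of "-1"] assms(2)]]
  by simp

lemma bounded_measurable_sum:
  assumes "\<And>a. a \<in> J \<Longrightarrow> bounded_measurable (g a)"
  shows "bounded_measurable (\<lambda>f. \<Sum>a\<in>J. g a f)"
proof (cases "finite J")
  case True
  then show ?thesis using assms
    by (induction J) (auto intro: bounded_measurable_add bounded_measurable_const)
qed (auto intro: bounded_measurable_const)

lemma bounded_measurable_cis: "bounded_measurable (\<lambda>f. cis (2 * pi * f * of_int n))"
proof -
  have "(\<lambda>f. cis (2 * pi * f * of_int n)) \<in> borel_measurable period"
    by (intro continuous_imp_measurable_on_sets_lebesgue continuous_intros) auto
  then show ?thesis unfolding bounded_measurable_def by (auto intro: exI[of _ 1])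
qed

lemma bounded_measurable_indicator:
  assumes "E \<in> sets lebesgue"
  shows "bounded_measurable (indicator E)"
proof -
  have "(indicator E :: real \<Rightarrow> complex) \<in> borel_measurable period"
    using assms by (intro measurable_restrict_space1) simp
  then show ?thesis unfolding bounded_measurable_def
    by (auto intro!: exI[of _ 1] simp: indicator_def)
qed

lemmas bounded_measurable_intros = bounded_measurable_add bounded_measurable_mult
  bounded_measurable_const bounded_measurable_cnj bounded_measurable_minus bounded_measurable_sum
  bounded_measurable_cis bounded_measurable_indicator

lemma integrable_bounded_measurable:
  assumes "bounded_measurable g"
  shows "integrable period g" and "integrable period (\<lambda>f. (cmod (g f))\<^sup>2)"
proof -
  obtain B where B: "\<And>f. cmod (g f) \<le> B" and m: "g \<in> borel_measurable period"
    using assms unfolding bounded_measurable_def by blast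
  show "integrable period g"
    using B m by (intro period.integrable_const_bound[of _ B]) auto
  show "integrable period (\<lambda>f. (cmod (g f))\<^sup>2)"
    using B m by (intro period.integrable_const_bound[of _ "B\<^sup>2"]) (auto intro!: power_mono)
qed

text \<open>The exponent has the sign of the inverse transform in \<open>dtft_is\<close>: this is
  the time signal with spectrum \<open>g\<close>.\<close>

definition fourier_coeff :: "(real \<Rightarrow> complex) \<Rightarrow> int \<Rightarrow> complex" where
  "fourier_coeff g n = (LINT f|period. g f * cis (2 * pi * f * of_int n))"

lemma fourier_coeff_sum:
  assumes "\<And>a. a \<in> J \<Longrightarrow> bounded_measurable (g a)"
  shows "fourier_coeff (\<lambda>f. \<Sum>a\<in>J. c a * g a f) n = (\<Sum>a\<in>J. c a * fourier_coeff (g a) n)"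
proof -
  have "fourier_coeff (\<lambda>f. \<Sum>a\<in>J. c a * g a f) n
      = (LINT f|period. (\<Sum>a\<in>J. c a * (g a f * cis (2 * pi * f * of_int n))))"
    by (simp add: fourier_coeff_def sum_distrib_right mult.assoc)
  also have "\<dots> = (\<Sum>a\<in>J. LINT f|period. c a * (g a f * cis (2 * pi * f * of_int n)))"
    by (intro Bochner_Integration.integral_sum integrable_bounded_measurable(1) bounded_measurable_intros assms)
  finally show ?thesis by (simp add: fourier_coeff_def)
qed

lemma integral_cis:
  "(LINT f|period. cis (2 * pi * f * of_int n)) = (if n = 0 then 1 else 0)"
proof -
  have "(LINT f|period. cis (2 * pi * f * of_int n)) = integral {-1/2..1/2} (\<lambda>f. cis (2 * pi * f * of_int n))"
    by (intro lebesgue_integral_eq_integral integrable_bounded_measurable bounded_measurable_cis) auto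
  also have "\<dots> = (if n = 0 then 1 else 0)"
  proof (cases "n = 0")
    case False
    define c where "c = 2 * pi * of_int n * \<i>"
    have c: "c \<noteq> 0" and cis_c: "cis (2 * pi * f * of_int n) = exp (c * of_real f)" for f
      using False by (auto simp: c_def cis_conv_exp mult_ac)
    have "((\<lambda>f. cis (2 * pi * f * of_int n)) has_integral
        cis (2 * pi * (1/2) * of_int n) / c - cis (2 * pi * (-1/2) * of_int n) / c) {-1/2..1/2}"
      unfolding cis_c
    proof (intro fundamental_theorem_of_calculus)
      fix x :: real
      have "((\<lambda>z. exp (c * z) / c) has_field_derivative exp (c * of_real x)) (at (of_real x))"
        using c by (auto intro!: derivative_eq_intros)
      then show "((\<lambda>f. exp (c * of_real f) / c) has_vector_derivative exp (c * of_real x))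
          (at x within {-1/2..1/2})"
        using has_vector_derivative_real_field has_vector_derivative_at_within by fastforce
    qed auto
    moreover have "cis (2 * pi * (1/2) * of_int n) = cis (2 * pi * (-1/2) * of_int n)"
    proof -
      have "cis (2 * pi * (1/2) * of_int n) = cis (2 * pi * (-1/2) * of_int n) * cis (2 * pi * of_int n)"
        unfolding cis_mult by (rule arg_cong[of _ _ cis]) simp
      then show ?thesis by (simp only: cis_multiple_2pi Ints_of_int mult_1_right)
    qed
    ultimately show ?thesis using False by (simp add: integral_unique)
  qed simp
  finally show ?thesis .
qed

section \<open>Trigonometric polynomials\<close>

inductive trig_poly :: "(real \<Rightarrow> complex) \<Rightarrow> bool" where
  monom: "trig_poly (\<lambda>f. c * cis (2 * pi * f * of_int n))"
| add: "trig_poly p \<Longrightarrow> trig_poly q \<Longrightarrow> trig_poly (\<lambda>f. p f + q f)"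

lemma trig_poly_const: "trig_poly (\<lambda>f. c)"
  using trig_poly.monom[of c 0] by simp

lemma trig_poly_mult:
  assumes "trig_poly p" "trig_poly q"
  shows "trig_poly (\<lambda>f. p f * q f)"
  using assms
proof (induction p)
  case (monom c n)
  from monom show ?case
  proof (induction q)
    case (monom d m)
    have "(\<lambda>f. c * cis (2 * pi * f * of_int n) * (d * cis (2 * pi * f * of_int m)))
        = (\<lambda>f. c * d * cis (2 * pi * f * of_int (n + m)))"
      by (simp add: fun_eq_iff cis_mult[symmetric] algebra_simps)
    then show ?case by (simp only: trig_poly.monom)
  qed (simp add: distrib_left trig_poly.add)
qed (simp add: distrib_right trig_poly.add)

lemma trig_poly_sum:
  assumes "\<And>a. a \<in> J \<Longrightarrow> trig_poly (p a)"
  shows "trig_poly (\<lambda>f. \<Sum>a\<in>J. p a f)"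
proof (cases "finite J")
  case True
  then show ?thesis using assms by (induction J) (auto intro: trig_poly_const trig_poly.add)
qed (auto intro: trig_poly_const)

lemma trig_poly_bounded_measurable: "trig_poly p \<Longrightarrow> bounded_measurable p"
  by (induction rule: trig_poly.induct) (intro bounded_measurable_intros; assumption)+

text \<open>The synthesis formula carries \<^term>\<open>cnj\<close> because \<^const>\<open>fourier_coeff\<close>
  integrates against \<^term>\<open>cis (2 * pi * f * of_int n)\<close>.\<close>

lemma trig_poly_repr:
  assumes "trig_poly p"
  obtains N d where "finite N" "p = (\<lambda>f. \<Sum>n\<in>N. d n * cnj (cis (2 * pi * f * of_int n)))"
  using assms
proof (induction arbitrary: thesis)
  case (monom c n)
  show ?case by (rule monom[of "{-n}" "\<lambda>_. c"]) (auto simp: cis_cnj)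
next
  case (add p q)
  obtain N d where N: "finite N" "p = (\<lambda>f. \<Sum>n\<in>N. d n * cnj (cis (2 * pi * f * of_int n)))"
    using add.IH(1) by blast
  obtain N' d' where N': "finite N'" "q = (\<lambda>f. \<Sum>n\<in>N'. d' n * cnj (cis (2 * pi * f * of_int n)))"
    using add.IH(2) by blast
  have ext: "(\<Sum>n\<in>A. e n * h n) = (\<Sum>n\<in>N \<union> N'. (if n \<in> A then e n else 0) * h n)"
    if "A \<subseteq> N \<union> N'" for A and e h :: "int \<Rightarrow> complex"
    using that N(1) N'(1) by (intro sum.mono_neutral_cong_left) auto
  show ?case
    by (rule add.prems[of "N \<union> N'" "\<lambda>n. (if n \<in> N then d n else 0) + (if n \<in> N' then d' n else 0)"])
       (auto simp: N N' ext[of N] ext[of N'] distrib_right sum.distrib)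
qed

text \<open>Completing the square with the orthonormal exponentials. Taking \<open>d\<close> to be
  the Fourier coefficients of \<open>g\<close> yields Bessel's inequality, \<open>g = 0\<close>
  yields the energy of a trigonometric polynomial, and a \<open>p\<close> close to \<open>g\<close>
  yields Parseval's identity.\<close>

lemma integral_square_diff_trig:
  assumes g: "bounded_measurable g" and "finite N"
    and p: "p = (\<lambda>f. \<Sum>n\<in>N. d n * cnj (cis (2 * pi * f * of_int n)))"
  shows "(LINT f|period. (cmod (g f - p f))\<^sup>2) = (LINT f|period. (cmod (g f))\<^sup>2)
    - (\<Sum>n\<in>N. (cmod (fourier_coeff g n))\<^sup>2) + (\<Sum>n\<in>N. (cmod (fourier_coeff g n - d n))\<^sup>2)"
proof -
  have pb: "bounded_measurable p"
    unfolding p by (intro bounded_measurable_intros)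
  have sq: "complex_of_real (LINT f|period. (cmod (h f))\<^sup>2) = (LINT f|period. h f * cnj (h f))" for h
    by (simp only: complex_norm_square flip: integral_complex_of_real)
  have ip: "(LINT f|period. h f * cnj (p f)) = (\<Sum>n\<in>N. cnj (d n) * fourier_coeff h n)"
    if "bounded_measurable h" for h
  proof -
    have "(LINT f|period. h f * cnj (p f))
        = (LINT f|period. (\<Sum>n\<in>N. cnj (d n) * (h f * cis (2 * pi * f * of_int n))))"
      by (simp add: p sum_distrib_left mult_ac)
    also have "\<dots> = (\<Sum>n\<in>N. LINT f|period. cnj (d n) * (h f * cis (2 * pi * f * of_int n)))"
      by (intro Bochner_Integration.integral_sum integrable_bounded_measurable(1)
          bounded_measurable_intros that)
    finally show ?thesis by (simp add: fourier_coeff_def)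
  qed
  have pc: "fourier_coeff p m = d m" if "m \<in> N" for m
  proof -
    have "fourier_coeff p m = (\<Sum>n\<in>N. d n * fourier_coeff (\<lambda>f. cnj (cis (2 * pi * f * of_int n))) m)"
      unfolding p by (intro fourier_coeff_sum bounded_measurable_intros)
    also have "\<dots> = (\<Sum>n\<in>N. d n * (if n = m then 1 else 0))"
    proof (intro sum.cong refl arg_cong2[where f="(*)"])
      fix n
      have "fourier_coeff (\<lambda>f. cnj (cis (2 * pi * f * of_int n))) m
          = (LINT f|period. cis (2 * pi * f * of_int (m - n)))"
        unfolding fourier_coeff_def by (simp add: cis_cnj cis_mult algebra_simps)
      then show "fourier_coeff (\<lambda>f. cnj (cis (2 * pi * f * of_int n))) m = (if n = m then 1 else 0)"
        by (simp only: integral_cis) auto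
    qed
    also have "\<dots> = d m" using that \<open>finite N\<close> by (simp add: if_distrib cong: if_cong)
    finally show ?thesis .
  qed
  have cnj_ip: "(LINT f|period. p f * cnj (g f)) = cnj (LINT f|period. g f * cnj (p f))"
    using Bochner_Integration.integral_cnj[of period "\<lambda>f. g f * cnj (p f)"] by (simp add: mult.commute)
  have "complex_of_real (LINT f|period. (cmod (g f - p f))\<^sup>2)
      = (LINT f|period. g f * cnj (g f) - g f * cnj (p f) - p f * cnj (g f) + p f * cnj (p f))"
    unfolding sq by (simp add: algebra_simps)
  also have "\<dots> = (LINT f|period. g f * cnj (g f)) - (LINT f|period. g f * cnj (p f))
      - (LINT f|period. p f * cnj (g f)) + (LINT f|period. p f * cnj (p f))"
    by (subst Bochner_Integration.integral_add Bochner_Integration.integral_diff,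
        (intro integrable_bounded_measurable bounded_measurable_intros g pb)+)+ simp
  also have "\<dots> = complex_of_real ((LINT f|period. (cmod (g f))\<^sup>2)
    - (\<Sum>n\<in>N. (cmod (fourier_coeff g n))\<^sup>2) + (\<Sum>n\<in>N. (cmod (fourier_coeff g n - d n))\<^sup>2))"
    unfolding cnj_ip ip[OF g] ip[OF pb] of_real_add of_real_diff sq of_real_sum complex_norm_square
    by (simp add: pc algebra_simps sum.distrib sum_subtractf)
  finally show ?thesis unfolding of_real_eq_iff .
qed

section \<open>Bessel's inequality and Parseval's identity\<close>

lemma bessel_finite:
  assumes "bounded_measurable g" "finite N"
  shows "(\<Sum>n\<in>N. (cmod (fourier_coeff g n))\<^sup>2) \<le> (LINT f|period. (cmod (g f))\<^sup>2)"
proof -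
  have "0 \<le> (LINT f|period. (cmod (g f - (\<Sum>n\<in>N. fourier_coeff g n * cnj (cis (2 * pi * f * of_int n)))))\<^sup>2)"
    by (intro Bochner_Integration.integral_nonneg) auto
  also have "\<dots> = (LINT f|period. (cmod (g f))\<^sup>2) - (\<Sum>n\<in>N. (cmod (fourier_coeff g n))\<^sup>2)"
    using integral_square_diff_trig[OF assms refl, of "fourier_coeff g"] by simp
  finally show ?thesis by simp
qed

lemma fourier_coeff_square_summable:
  assumes "bounded_measurable g"
  shows "(\<lambda>n. (cmod (fourier_coeff g n))\<^sup>2) summable_on T"
  by (rule nonneg_bdd_above_summable_on) (auto simp: bdd_above_def intro!: bessel_finite assms exI)

lemma bessel:
  assumes "bounded_measurable g"
  shows "(\<Sum>\<^sub>\<infinity>n. (cmod (fourier_coeff g n))\<^sup>2) \<le> (LINT f|period. (cmod (g f))\<^sup>2)"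
  by (intro infsum_le_finite_sums fourier_coeff_square_summable bessel_finite assms)

text \<open>Approximation in mean square is the completeness that Parseval's identity needs. It has
  to be established only for the spectra that occur: sums of indicators times trigonometric
  polynomials.\<close>

definition trig_approximable :: "(real \<Rightarrow> complex) \<Rightarrow> bool" where
  "trig_approximable g \<longleftrightarrow> bounded_measurable g \<and>
    (\<forall>\<epsilon>>0. \<exists>p. trig_poly p \<and> (LINT f|period. (cmod (g f - p f))\<^sup>2) < \<epsilon>)"

text \<open>If \<open>p\<close> is within \<open>\<epsilon>\<close> of \<open>g\<close> in squared
  distance, the coefficients of \<open>g\<close> at the frequencies of \<open>p\<close> already
  carry all but \<open>\<epsilon>\<close> of the energy, since the Fourier coefficients are the best
  choice of \<open>d\<close>.\<close>

lemma parseval: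
  assumes "trig_approximable g"
  shows "(\<Sum>\<^sub>\<infinity>n. (cmod (fourier_coeff g n))\<^sup>2) = (LINT f|period. (cmod (g f))\<^sup>2)"
proof (rule antisym)
  have g: "bounded_measurable g" using assms trig_approximable_def by blast
  then show "(\<Sum>\<^sub>\<infinity>n. (cmod (fourier_coeff g n))\<^sup>2) \<le> (LINT f|period. (cmod (g f))\<^sup>2)"
    by (rule bessel)
  show "(LINT f|period. (cmod (g f))\<^sup>2) \<le> (\<Sum>\<^sub>\<infinity>n. (cmod (fourier_coeff g n))\<^sup>2)"
  proof (rule field_le_epsilon)
    fix \<epsilon> :: real assume "\<epsilon> > 0"
    then obtain p where "trig_poly p" and lt: "(LINT f|period. (cmod (g f - p f))\<^sup>2) < \<epsilon>"
      using assms unfolding trig_approximable_def by blast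
    then obtain N d where N: "finite N" "p = (\<lambda>f. \<Sum>n\<in>N. d n * cnj (cis (2 * pi * f * of_int n)))"
      using trig_poly_repr by blast
    have "0 \<le> (\<Sum>n\<in>N. (cmod (fourier_coeff g n - d n))\<^sup>2)" by (intro sum_nonneg) auto
    with lt have "(LINT f|period. (cmod (g f))\<^sup>2) \<le> (\<Sum>n\<in>N. (cmod (fourier_coeff g n))\<^sup>2) + \<epsilon>"
      using integral_square_diff_trig[OF g N] by linarith
    also have "(\<Sum>n\<in>N. (cmod (fourier_coeff g n))\<^sup>2) \<le> (\<Sum>\<^sub>\<infinity>n. (cmod (fourier_coeff g n))\<^sup>2)"
      by (intro finite_sum_le_infsum fourier_coeff_square_summable g N(1)) auto
    finally show "(LINT f|period. (cmod (g f))\<^sup>2) \<le> (\<Sum>\<^sub>\<infinity>n. (cmod (fourier_coeff g n))\<^sup>2) + \<epsilon>" by simp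
  qed
qed

section \<open>Functions approximable by trigonometric polynomials\<close>

lemma trig_approximable_add:
  assumes "trig_approximable g" "trig_approximable h"
  shows "trig_approximable (\<lambda>f. g f + h f)"
  unfolding trig_approximable_def
proof (intro conjI allI impI)
  have gh: "bounded_measurable g" "bounded_measurable h"
    using assms trig_approximable_def by auto
  then show "bounded_measurable (\<lambda>f. g f + h f)" by (rule bounded_measurable_add)
  fix \<epsilon> :: real assume "\<epsilon> > 0"
  \<comment> \<open>Squaring the sum of the two errors costs a factor 2 on each.\<close>
  then have "\<epsilon> / 4 > 0" by simp
  then obtain p q where p: "trig_poly p" "(LINT f|period. (cmod (g f - p f))\<^sup>2) < \<epsilon> / 4"
    and q: "trig_poly q" "(LINT f|period. (cmod (h f - q f))\<^sup>2) < \<epsilon> / 4"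
    using assms unfolding trig_approximable_def by blast
  have bm: "bounded_measurable (\<lambda>f. g f - p f)" "bounded_measurable (\<lambda>f. h f - q f)"
    by (intro bounded_measurable_minus gh trig_poly_bounded_measurable p q)+
  have "(LINT f|period. (cmod (g f + h f - (p f + q f)))\<^sup>2)
      \<le> (LINT f|period. 2 * (cmod (g f - p f))\<^sup>2 + 2 * (cmod (h f - q f))\<^sup>2)"
  proof (rule integral_mono)
    show "integrable period (\<lambda>f. (cmod (g f + h f - (p f + q f)))\<^sup>2)"
      by (intro integrable_bounded_measurable bounded_measurable_minus bounded_measurable_add gh
          trig_poly_bounded_measurable p q)
    show "integrable period (\<lambda>f. 2 * (cmod (g f - p f))\<^sup>2 + 2 * (cmod (h f - q f))\<^sup>2)"
      by (intro Bochner_Integration.integrable_add integrable_mult_right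
          integrable_bounded_measurable bm)
    show "(cmod (g f + h f - (p f + q f)))\<^sup>2 \<le> 2 * (cmod (g f - p f))\<^sup>2 + 2 * (cmod (h f - q f))\<^sup>2" for f
      using cmod_add_square_le[of "g f - p f" "h f - q f"] by (simp add: algebra_simps)
  qed
  also have "\<dots> = 2 * (LINT f|period. (cmod (g f - p f))\<^sup>2) + 2 * (LINT f|period. (cmod (h f - q f))\<^sup>2)"
    using bm[THEN integrable_bounded_measurable(2)] by simp
  also have "\<dots> < \<epsilon>" using p q by simp
  finally show "\<exists>r. trig_poly r \<and> (LINT f|period. (cmod (g f + h f - r f))\<^sup>2) < \<epsilon>"
    using trig_poly.add[OF p(1) q(1)] by blast
qed

lemma trig_approximable_mult:
  assumes "trig_approximable g" "trig_poly t"
  shows "trig_approximable (\<lambda>f. g f * t f)"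
  unfolding trig_approximable_def
proof (intro conjI allI impI)
  have g: "bounded_measurable g" and t: "bounded_measurable t"
    using assms trig_approximable_def trig_poly_bounded_measurable by auto
  then show "bounded_measurable (\<lambda>f. g f * t f)" by (rule bounded_measurable_mult)
  obtain B where B: "\<And>f. cmod (t f) \<le> B" using t unfolding bounded_measurable_def by blast
  \<comment> \<open>The added 1 keeps \<open>K\<close> positive, so that an error
    \<open>\<epsilon> / K\<close> can be requested.\<close>
  define K where "K = B\<^sup>2 + 1"
  have K: "K > 0" and tK: "(cmod (t f))\<^sup>2 \<le> K" for f
    using power_mono[OF B, of f 2] unfolding K_def by (auto intro: add_nonneg_pos)
  fix \<epsilon> :: real assume "\<epsilon> > 0"
  then have "\<epsilon> / K > 0" using K by simp
  then obtain p where p: "trig_poly p" "(LINT f|period. (cmod (g f - p f))\<^sup>2) < \<epsilon> / K"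
    using assms unfolding trig_approximable_def by blast
  have bm: "bounded_measurable (\<lambda>f. g f - p f)"
    by (intro bounded_measurable_minus g trig_poly_bounded_measurable p)
  have "(LINT f|period. (cmod (g f * t f - p f * t f))\<^sup>2) \<le> (LINT f|period. K * (cmod (g f - p f))\<^sup>2)"
  proof (rule integral_mono)
    show "integrable period (\<lambda>f. (cmod (g f * t f - p f * t f))\<^sup>2)"
      by (intro integrable_bounded_measurable bounded_measurable_minus bounded_measurable_mult g t
          trig_poly_bounded_measurable p)
    show "integrable period (\<lambda>f. K * (cmod (g f - p f))\<^sup>2)"
      by (intro integrable_mult_right integrable_bounded_measurable bm)
    show "(cmod (g f * t f - p f * t f))\<^sup>2 \<le> K * (cmod (g f - p f))\<^sup>2" for f
      using mult_right_mono[OF tK[of f], of "(cmod (g f - p f))\<^sup>2"]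
      by (simp add: norm_mult power_mult_distrib mult.commute flip: left_diff_distrib)
  qed
  also have "\<dots> = K * (LINT f|period. (cmod (g f - p f))\<^sup>2)" by simp
  also have "\<dots> < \<epsilon>" using p K by (simp add: field_simps)
  finally show "\<exists>r. trig_poly r \<and> (LINT f|period. (cmod (g f * t f - r f))\<^sup>2) < \<epsilon>"
    using trig_poly_mult[OF p(1) assms(2)] by blast
qed

lemma trig_poly_approximable:
  assumes "trig_poly p"
  shows "trig_approximable p"
  unfolding trig_approximable_def
proof (intro conjI allI impI)
  show "bounded_measurable p" by (rule trig_poly_bounded_measurable[OF assms])
  show "\<exists>q. trig_poly q \<and> (LINT f|period. (cmod (p f - q f))\<^sup>2) < \<epsilon>" if "\<epsilon> > 0" for \<epsilon>
    using assms that by (intro exI[of _ p]) auto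
qed

lemma trig_approximable_sum:
  assumes "\<And>a. a \<in> J \<Longrightarrow> trig_approximable (g a)"
  shows "trig_approximable (\<lambda>f. \<Sum>a\<in>J. g a f)"
proof (cases "finite J")
  case True
  then show ?thesis using assms
    by (induction J) (auto intro: trig_approximable_add trig_poly_approximable trig_poly_const)
qed (auto intro: trig_poly_approximable trig_poly_const)

text \<open>On the unit circle a real linear functional is a combination of cosine and sine, hence
  of the exponentials of degree 1 and -1; sums and products stay trigonometric. This transfers
  polynomial approximation in the plane to the period.\<close>

lemma trig_poly_real_polynomial:
  assumes "real_polynomial_function h"
  shows "trig_poly (\<lambda>f. complex_of_real (h (cis (2 * pi * f))))"
  using assms
proof (induction rule: real_polynomial_function.induct)
  case (linear h)
  interpret bounded_linear h by fact
  have "h (cis (2 * pi * f)) = cos (2 * pi * f) * h 1 + sin (2 * pi * f) * h \<i>" for f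
  proof -
    have "cis (2 * pi * f) = cos (2 * pi * f) *\<^sub>R 1 + sin (2 * pi * f) *\<^sub>R \<i>"
      by (simp add: complex_eq_iff)
    then show ?thesis by (simp only: add scaleR real_scaleR_def)
  qed
  then have "(\<lambda>f. complex_of_real (h (cis (2 * pi * f))))
      = (\<lambda>f. (h 1 - \<i> * h \<i>) / 2 * cis (2 * pi * f * of_int 1) + (h 1 + \<i> * h \<i>) / 2 * cis (2 * pi * f * of_int (-1)))"
    by (simp add: fun_eq_iff complex_eq_iff field_simps)
  then show ?case by (simp only: trig_poly.intros)
next
  case (add h1 h2)
  then show ?case using trig_poly.add[OF add.IH] by simp
next
  case (mult h1 h2)
  then show ?case using trig_poly_mult[OF mult.IH] by simp
qed (auto intro: trig_poly_const)

text \<open>Regularity of Lebesgue measure and Urysohn's lemma on the unit circle give a continuous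
  approximation, to which the Stone--Weierstrass theorem applies.\<close>

lemma trig_approximable_indicator:
  assumes E: "E \<in> sets lebesgue"
  shows "trig_approximable (indicator E)"
  unfolding trig_approximable_def
proof (intro conjI allI impI)
  show bmE: "bounded_measurable (indicator E)" by (rule bounded_measurable_indicator[OF E])
  fix \<epsilon> :: real assume \<epsilon>: "\<epsilon> > 0"
  \<comment> \<open>The two endpoints have the same image on the circle, so a continuous function
    there cannot separate them; they are removed and later absorbed in the null part of
    \<open>bad\<close>.\<close>
  define E0 where "E0 = E \<inter> {-1/2<..<1/2}"
  have E0: "E0 \<in> sets lebesgue" using E by (auto simp: E0_def)
  \<comment> \<open>The budget: two gaps of measure below \<open>\<epsilon>/16\<close> give
    \<open>bad\<close> measure at most \<open>\<epsilon>/8\<close>, and a uniform error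
    \<open>sqrt (\<epsilon>/8)\<close> squares to \<open>\<epsilon>/8\<close>. Each part is doubled
    when the errors are added, for a total of at most \<open>\<epsilon>/2\<close>.\<close>
  obtain K where K: "closed K" "K \<subseteq> E0" "E0 - K \<in> lmeasurable" "emeasure lebesgue (E0 - K) < ennreal (\<epsilon>/16)"
    using sets_lebesgue_inner_closed[OF E0, of "\<epsilon>/16"] \<epsilon> by auto
  obtain U where U: "open U" "E0 \<subseteq> U" "U - E0 \<in> lmeasurable" "emeasure lebesgue (U - E0) < ennreal (\<epsilon>/16)"
    using sets_lebesgue_outer_open[OF E0, of "\<epsilon>/16"] \<epsilon> by auto
  define C where "C = {-1/2..1/2} - (U \<inter> {-1/2<..<1/2})"
  define \<kappa> where "\<kappa> f = cis (2 * pi * f)" for f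
  have \<kappa>: "continuous_on A \<kappa>" for A unfolding \<kappa>_def by (intro continuous_intros)
  have "K \<subseteq> {-1/2..1/2}" using K(2) by (auto simp: E0_def)
  then have "compact K"
    using K(1) bounded_subset[OF bounded_closed_interval] by (simp add: compact_eq_bounded_closed)
  moreover have "compact C"
    unfolding C_def using U(1) by (intro compact_diff open_Int) auto
  ultimately have closed: "closed (\<kappa> ` K)" "closed (\<kappa> ` C)"
    by (auto intro: compact_imp_closed compact_continuous_image \<kappa>)
  \<comment> \<open>Equal images force \<open>k - c\<close> to be an integer. It is 0 because
    \<open>k\<close> lies in the open interval and \<open>c\<close> in the closed one, and
    \<open>K\<close> does not meet \<open>C\<close>.\<close>
  have "\<kappa> k \<noteq> \<kappa> c" if "k \<in> K" "c \<in> C" for k c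
  proof
    assume "\<kappa> k = \<kappa> c"
    then have "sin (2 * pi * k) = sin (2 * pi * c) \<and> cos (2 * pi * k) = cos (2 * pi * c)"
      unfolding \<kappa>_def by (auto simp: complex_eq_iff)
    then obtain n :: int where "2 * pi * k = 2 * pi * c + 2 * pi * n"
      unfolding sin_cos_eq_iff by blast
    then have "2 * pi * (k - c) = 2 * pi * n" by (simp add: algebra_simps)
    then have kc: "k - c = n" using pi_gt_zero by (metis mult_cancel_left mult_eq_0_iff pi_neq_zero zero_neq_numeral)
    have "k \<in> {-1/2<..<1/2}" "c \<in> {-1/2..1/2}"
      using that K(2) by (auto simp: E0_def C_def)
    with kc have "n = 0" by simp
    with kc have "k = c" by simp
    then show False using that K(2) U(2) by (auto simp: E0_def C_def)
  qed
  then have disj: "\<kappa> ` K \<inter> \<kappa> ` C = {}" by auto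
  obtain G :: "complex \<Rightarrow> real" where G: "continuous_on UNIV G" "\<And>z. G z \<in> closed_segment 1 0"
    "\<And>z. z \<in> \<kappa> ` K \<Longrightarrow> G z = 1" "\<And>z. z \<in> \<kappa> ` C \<Longrightarrow> G z = 0"
    using Urysohn[OF closed disj, of 1 0] by blast
  have G01: "0 \<le> G z" "G z \<le> 1" for z
    using G(2)[of z] by (auto simp: closed_segment_eq_real_ivl)
  have "compact (\<kappa> ` {-1/2..1/2})" by (intro compact_continuous_image \<kappa>) auto
  moreover have "continuous_on (\<kappa> ` {-1/2..1/2}) G" using G(1) continuous_on_subset by blast
  ultimately obtain h where h: "real_polynomial_function h"
    "\<And>z. z \<in> \<kappa> ` {-1/2..1/2} \<Longrightarrow> \<bar>G z - h z\<bar> < sqrt (\<epsilon>/8)"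
    using Stone_Weierstrass_real_polynomial_function[of "\<kappa> ` {-1/2..1/2}" G "sqrt (\<epsilon>/8)"] \<epsilon> by auto
  define p where "p f = complex_of_real (h (\<kappa> f))" for f
  have p: "trig_poly p" unfolding p_def \<kappa>_def by (rule trig_poly_real_polynomial[OF h(1)])
  \<comment> \<open>Off \<open>bad\<close>, a point of the period lies in \<open>K\<close>, where
    the Urysohn function is 1, or in \<open>C\<close> and outside \<open>E\<close>, where it is 0;
    there it equals the indicator of \<open>E\<close>.\<close>
  define bad where "bad = (E0 - K) \<union> (U - E0) \<union> {-1/2, 1/2}"
  have ends: "{-1/2, 1/2 :: real} \<in> null_sets lebesgue"
    by (simp only: negligible_iff_null_sets[symmetric] negligible_finite finite.intros)
  have bad: "bad \<in> sets lebesgue" unfolding bad_def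
    by (intro sets.Un fmeasurableD[OF K(3)] fmeasurableD[OF U(3)] null_setsD2[OF ends])
  have bad_m: "measure lebesgue (bad \<inter> {-1/2..1/2}) \<le> \<epsilon>/8"
  proof -
    have "emeasure lebesgue bad \<le> emeasure lebesgue ((E0 - K) \<union> (U - E0)) + emeasure lebesgue {-1/2, 1/2::real}"
      unfolding bad_def
      by (intro emeasure_subadditive sets.Un fmeasurableD[OF K(3)] fmeasurableD[OF U(3)] null_setsD2[OF ends])
    also have "emeasure lebesgue {-1/2, 1/2::real} = 0"
      by (rule null_setsD1[OF ends])
    also have "emeasure lebesgue ((E0 - K) \<union> (U - E0)) \<le> emeasure lebesgue (E0 - K) + emeasure lebesgue (U - E0)"
      by (intro emeasure_subadditive fmeasurableD[OF K(3)] fmeasurableD[OF U(3)])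
    also have "\<dots> \<le> ennreal (\<epsilon>/16) + ennreal (\<epsilon>/16)"
      using K(4) U(4) by (intro add_mono) auto
    also have "\<dots> = ennreal (\<epsilon>/8)" using \<epsilon> by (simp flip: ennreal_plus)
    finally have "emeasure lebesgue bad \<le> ennreal (\<epsilon>/8)" by (simp add: add_right_mono)
    then have "emeasure lebesgue (bad \<inter> {-1/2..1/2}) \<le> ennreal (\<epsilon>/8)"
      using emeasure_mono[of "bad \<inter> {-1/2..1/2}" bad lebesgue] bad by (auto intro: order_trans)
    then show ?thesis unfolding measure_def using \<epsilon> by (intro enn2real_leI) simp_all
  qed
  have "(LINT f|period. (cmod (indicator E f - p f))\<^sup>2) \<le> (LINT f|period. 2 * indicator bad f + \<epsilon>/4)"
  proof (rule integral_mono)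
    show "integrable period (\<lambda>f. (cmod (indicator E f - p f))\<^sup>2)"
      by (intro integrable_bounded_measurable bounded_measurable_minus bmE trig_poly_bounded_measurable p)
    have "integrable period (indicator bad :: real \<Rightarrow> real)"
      using bad by (intro period.integrable_const_bound[of _ 1] measurable_restrict_space1) auto
    then show "integrable period (\<lambda>f. 2 * indicator bad f + \<epsilon>/4)" by simp
    fix f assume "f \<in> space period"
    then have f: "f \<in> {-1/2..1/2}" by (simp add: space_restrict_space)
    have "(cmod (indicator E f - p f))\<^sup>2
        \<le> 2 * (cmod (indicator E f - of_real (G (\<kappa> f))))\<^sup>2 + 2 * (cmod (of_real (G (\<kappa> f)) - p f))\<^sup>2"
      using cmod_add_square_le[of "indicator E f - of_real (G (\<kappa> f))" "of_real (G (\<kappa> f)) - p f"] by simp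
    moreover have "(cmod (indicator E f - of_real (G (\<kappa> f))))\<^sup>2 \<le> indicator bad f"
    proof (cases "f \<in> bad")
      case True
      have "indicator E f - complex_of_real (G (\<kappa> f)) = of_real (indicator E f - G (\<kappa> f))"
        by (simp add: indicator_def)
      then have "cmod (indicator E f - of_real (G (\<kappa> f))) = \<bar>indicator E f - G (\<kappa> f)\<bar>"
        by (simp only: norm_of_real)
      also have "\<dots> \<le> 1" using G01[of "\<kappa> f"] by (auto simp: indicator_def)
      finally show ?thesis using True power_mono[of _ 1 2] by fastforce
    next
      case False
      then have fi: "f \<in> {-1/2<..<1/2}" using f by (auto simp: bad_def less_le)
      show ?thesis
      proof (cases "f \<in> K")
        case True
        then show ?thesis using G(3)[of "\<kappa> f"] K(2) by (auto simp: E0_def)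
      next
        case nK: False
        then have "f \<notin> U" "f \<notin> E0" using False by (auto simp: bad_def)
        then have "f \<in> C" "f \<notin> E" using fi by (auto simp: C_def E0_def)
        then show ?thesis using G(4)[of "\<kappa> f"] by auto
      qed
    qed
    moreover have "(cmod (of_real (G (\<kappa> f)) - p f))\<^sup>2 \<le> \<epsilon>/8"
    proof -
      have "cmod (of_real (G (\<kappa> f)) - p f) \<le> sqrt (\<epsilon>/8)"
        using h(2)[of "\<kappa> f"] f by (simp add: p_def flip: of_real_diff)
      then show ?thesis using power_mono[of _ "sqrt (\<epsilon>/8)" 2] \<epsilon> by fastforce
    qed
    ultimately show "(cmod (indicator E f - p f))\<^sup>2 \<le> 2 * indicator bad f + \<epsilon>/4" by linarith
  qed
  also have "\<dots> = 2 * measure lebesgue (bad \<inter> {-1/2..1/2}) + \<epsilon>/4"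
  proof -
    have "integrable period (indicator bad :: real \<Rightarrow> real)"
      using bad by (intro period.integrable_const_bound[of _ 1] measurable_restrict_space1) auto
    then show ?thesis
      by (simp add: measure_restrict_space space_restrict_space)
  qed
  also have "\<dots> < \<epsilon>" using bad_m \<epsilon> by simp
  finally show "\<exists>p. trig_poly p \<and> (LINT f|period. (cmod (indicator E f - p f))\<^sup>2) < \<epsilon>"
    using p by blast
qed

subsection \<open>Density of stable samples\<close>

lemma has_sum_finite_Times:
  fixes h :: "'q \<Rightarrow> 'k \<Rightarrow> 'b::{topological_comm_monoid_add, t2_space}"
  assumes "finite Q" "\<And>q. q \<in> Q \<Longrightarrow> (h q has_sum s q) T"
  shows "((\<lambda>(q, k). h q k) has_sum (\<Sum>q\<in>Q. s q)) (Q \<times> T)"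
  using assms
proof (induction Q rule: finite_induct)
  case (insert q Q)
  have "((\<lambda>(q, k). h q k) has_sum s q) (Pair q ` T)"
    using insert.prems[of q] by (subst has_sum_reindex) (auto simp: inj_on_def o_def)
  then have "((\<lambda>(q, k). h q k) has_sum (s q + (\<Sum>q\<in>Q. s q))) (Pair q ` T \<union> Q \<times> T)"
    using insert by (intro has_sum_Un_disjoint) auto
  moreover have "Pair q ` T \<union> Q \<times> T = insert q Q \<times> T" by auto
  ultimately show ?case using insert.hyps by simp
qed simp

lemma infsum_tail_tendsto:
  fixes g :: "int \<Rightarrow> real"
  assumes "\<And>k. 0 \<le> g k" "g summable_on UNIV"
  shows "(\<lambda>R::nat. \<Sum>\<^sub>\<infinity>k\<in>{k. int R < \<bar>k\<bar>}. g k) \<longlonglongrightarrow> 0"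
proof (rule LIMSEQ_I)
  fix r :: real assume "0 < r"
  then obtain F where F: "finite F" "dist (sum g F) (infsum g UNIV) \<le> r / 2"
    using infsum_finite_approximation[OF assms(2), of "r/2"] by auto
  define R0 where "R0 = Max (insert 0 ((\<lambda>k. nat \<bar>k\<bar>) ` F))"
  have R0: "nat \<bar>k\<bar> \<le> R0" if "k \<in> F" for k
    unfolding R0_def using that F(1) by (intro Max_ge) auto
  have s: "g summable_on A" for A using summable_on_subset_banach[OF assms(2)] by auto
  show "\<exists>no. \<forall>R\<ge>no. norm ((\<Sum>\<^sub>\<infinity>k\<in>{k. int R < \<bar>k\<bar>}. g k) - 0) < r"
  proof (intro exI allI impI)
    fix R assume "R0 \<le> R"
    then have sub: "{k. int R < \<bar>k\<bar>} \<subseteq> - F" using R0 by fastforce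
    have "(\<Sum>\<^sub>\<infinity>k\<in>{k. int R < \<bar>k\<bar>}. g k) \<le> infsum g (- F)"
      using sub assms(1) s by (intro infsum_mono2) auto
    also have "\<dots> = infsum g UNIV - sum g F"
      using infsum_Un_disjoint[OF s s, of F "- F"] F(1) by simp
    also have "\<dots> < r" using F(2) \<open>0 < r\<close> unfolding dist_real_def by linarith
    finally show "norm ((\<Sum>\<^sub>\<infinity>k\<in>{k. int R < \<bar>k\<bar>}. g k) - 0) < r"
      by (simp add: infsum_nonneg assms(1))
  qed
qed

text \<open>Modulating the spectrum translates the signal in time, so the projections of all
  impulses onto one band are translates of a single kernel.\<close>

lemma fourier_coeff_shift:
  "fourier_coeff (\<lambda>f. g f * cnj (cis (2 * pi * f * of_int n))) k = fourier_coeff g (k - n)"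
  unfolding fourier_coeff_def
  by (simp add: cis_cnj cis_mult mult.assoc algebra_simps)

lemma integral_indicator_square:
  assumes "E \<in> sets lebesgue" "E \<subseteq> {-1/2..1/2}"
  shows "(LINT f|period. (cmod (indicator E f))\<^sup>2) = measure lebesgue E"
proof -
  have "(\<lambda>f. (cmod (indicator E f))\<^sup>2) = (indicator E :: real \<Rightarrow> real)"
    by (auto simp: indicator_def)
  moreover have "E \<inter> {- (1/2)..1/2} = E" using assms(2) by auto
  ultimately show ?thesis using assms
    by (simp add: measure_restrict_space space_restrict_space)
qed

lemma integral_trig_square:
  assumes "finite N"
  shows "(LINT f|period. (cmod (\<Sum>n\<in>N. d n * cnj (cis (2 * pi * f * of_int n))))\<^sup>2)
    = (\<Sum>n\<in>N. (cmod (d n))\<^sup>2)"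
proof -
  have "fourier_coeff (\<lambda>_. 0) n = 0" for n by (simp add: fourier_coeff_def)
  then show ?thesis
    using integral_square_diff_trig[OF bounded_measurable_const[of 0] assms refl, of d] by simp
qed

text \<open>Testing the frame inequality on the projections onto the band-limited
  space of the unit impulses at times in \<^term>\<open>{-int N..int N}\<close> gives at least
  \<^term>\<open>(2 * real N + 1) * (\<Sum>q\<in>Q. measure lebesgue (E q))\<close> samples in a slightly larger window, up to
  the tails of the square-summable convolution kernels.\<close>

lemma density_lower_bound:
  fixes E :: "'q \<Rightarrow> real set" and M :: "'v::finite \<Rightarrow> 'q \<Rightarrow> complex" and T :: "('v \<times> int) set"
  assumes Q: "finite Q"
    and E: "\<And>q. q \<in> Q \<Longrightarrow> E q \<in> sets lebesgue" "\<And>q. q \<in> Q \<Longrightarrow> E q \<subseteq> {-1/2..1/2}"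
    and \<alpha>: "0 \<le> \<alpha>"
    and low: "\<And>p. (\<And>q. trig_poly (p q)) \<Longrightarrow>
      (\<Sum>q\<in>Q. \<Sum>\<^sub>\<infinity>k. (cmod (fourier_coeff (\<lambda>f. indicator (E q) f * p q f) k))\<^sup>2)
      \<le> \<alpha> * (\<Sum>\<^sub>\<infinity>(v, k)\<in>T. (cmod (\<Sum>q\<in>Q. M v q * fourier_coeff (\<lambda>f. indicator (E q) f * p q f) k))\<^sup>2)"
  shows "ereal (\<Sum>q\<in>Q. measure lebesgue (E q))
    \<le> liminf (\<lambda>n::nat. ereal (real (card (T \<inter> (UNIV \<times> {-int n..int n}))) / (2 * real n)))"
proof -
  \<comment> \<open>The convolution kernel of the projection onto the band \<open>E q\<close>. By
    Parseval its energy is the measure of the band, which is how the measures enter the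
    count.\<close>
  define \<kappa> where "\<kappa> q = fourier_coeff (indicator (E q))" for q
  define D where "D = (\<Sum>q\<in>Q. measure lebesgue (E q))"
  define tail where "tail R = (\<Sum>q\<in>Q. \<Sum>v\<in>UNIV. (cmod (M v q))\<^sup>2 * (\<Sum>\<^sub>\<infinity>k\<in>{k. int R < \<bar>k\<bar>}. (cmod (\<kappa> q k))\<^sup>2))"
    for R :: nat
  have bmE: "bounded_measurable (indicator (E q))" if "q \<in> Q" for q
    using E(1)[OF that] by (rule bounded_measurable_indicator)
  have \<kappa>_sum: "(\<lambda>k. (cmod (\<kappa> q k))\<^sup>2) summable_on A" if "q \<in> Q" for q A
    unfolding \<kappa>_def by (rule fourier_coeff_square_summable[OF bmE[OF that]])
  have \<kappa>_norm: "(\<Sum>\<^sub>\<infinity>k. (cmod (\<kappa> q k))\<^sup>2) = measure lebesgue (E q)" if "q \<in> Q" for q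
    unfolding \<kappa>_def
    using parseval[OF trig_approximable_indicator] integral_indicator_square E that by metis
  have shift_bij: "bij_betw (\<lambda>k. k - n) UNIV (UNIV :: int set)" for n
    by (rule bij_betw_byWitness[of _ "\<lambda>k. k + n"]) auto
  have \<kappa>_shift: "(\<lambda>k. (cmod (\<kappa> q (k - n)))\<^sup>2) summable_on A"
    "(\<Sum>\<^sub>\<infinity>k. (cmod (\<kappa> q (k - n)))\<^sup>2) = measure lebesgue (E q)" if "q \<in> Q" for q n A
  proof -
    have "(\<lambda>k. (cmod (\<kappa> q (k - n)))\<^sup>2) summable_on UNIV"
      using summable_on_reindex_bij_betw[OF shift_bij, of "\<lambda>k. (cmod (\<kappa> q k))\<^sup>2"] \<kappa>_sum[OF that] by auto
    then show "(\<lambda>k. (cmod (\<kappa> q (k - n)))\<^sup>2) summable_on A"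
      using summable_on_subset_banach by blast
    show "(\<Sum>\<^sub>\<infinity>k. (cmod (\<kappa> q (k - n)))\<^sup>2) = measure lebesgue (E q)"
      using infsum_reindex_bij_betw[OF shift_bij, of "\<lambda>k. (cmod (\<kappa> q k))\<^sup>2"] \<kappa>_norm[OF that] by auto
  qed
  \<comment> \<open>The finite form of the claim: impulses at times in
    \<open>{-int N..int N}\<close>, samples counted with a margin \<open>R\<close> on each
    side.\<close>
  have count: "(2 * real N + 1) * (D - \<alpha> * tail R) \<le> real (card (T \<inter> (UNIV \<times> {-int (N + R)..int (N + R)})))"
    for N R
  proof -
    define S where "S = T \<inter> (UNIV \<times> {-int (N + R)..int (N + R)})"
    define I where "I = {-int N..int N}"
    have cardI: "real (card I) = 2 * real N + 1" by (simp add: I_def)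
    \<comment> \<open>\<open>x (q, n)\<close> is the impulse in channel \<open>q\<close> at time
      \<open>n\<close>, projected onto the band; \<open>y (q, n)\<close> is the vertex signal that
      it produces.\<close>
    define x where "x = (\<lambda>(q, n) (q', k). if q' = q then \<kappa> q (k - n) else 0)"
    define y where "y = (\<lambda>(q, n) (v, k). M v q * \<kappa> q (k - n))"
    have S: "finite S" unfolding S_def by (rule finite_Int) auto
    have x_hs: "((\<lambda>w. (cmod (x (q, n) w))\<^sup>2) has_sum measure lebesgue (E q)) (Q \<times> UNIV)" if "q \<in> Q" for q n
    proof -
      have "((\<lambda>k. (cmod (x (q, n) (q', k)))\<^sup>2) has_sum (if q' = q then measure lebesgue (E q) else 0)) UNIV" for q'
        using \<kappa>_shift[OF that] by (auto simp: x_def has_sum_iff)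
      then have "((\<lambda>(q', k). (cmod (x (q, n) (q', k)))\<^sup>2) has_sum
          (\<Sum>q'\<in>Q. if q' = q then measure lebesgue (E q) else 0)) (Q \<times> UNIV)"
        by (intro has_sum_finite_Times Q)
      then show ?thesis using Q that by (simp add: case_prod_unfold)
    qed
    have y_s: "(\<lambda>w. (cmod (y (q, n) w))\<^sup>2) summable_on A" if "q \<in> Q" for q n A
    proof -
      have "((\<lambda>(v, k). (cmod (y (q, n) (v, k)))\<^sup>2) has_sum
          (\<Sum>v\<in>UNIV. \<Sum>\<^sub>\<infinity>k. (cmod (y (q, n) (v, k)))\<^sup>2)) (UNIV \<times> UNIV)"
        using \<kappa>_shift(1)[OF that]
        by (intro has_sum_finite_Times has_sum_infsum)
           (auto simp: y_def intro!: summable_on_square_cmult)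
      then have "(\<lambda>w. (cmod (y (q, n) w))\<^sup>2) summable_on UNIV"
        by (auto simp: case_prod_unfold summable_on_def)
      then show ?thesis using summable_on_subset_banach by blast
    qed
    have y_far: "(\<Sum>\<^sub>\<infinity>w\<in>T - S. (cmod (y (q, n) w))\<^sup>2)
        \<le> (\<Sum>v\<in>UNIV. (cmod (M v q))\<^sup>2 * (\<Sum>\<^sub>\<infinity>k\<in>{k. int R < \<bar>k\<bar>}. (cmod (\<kappa> q k))\<^sup>2))"
      if "q \<in> Q" "n \<in> I" for q n
    proof -
      have inj: "inj_on (\<lambda>k. k + n) {k. int R < \<bar>k\<bar>}" by (auto simp: inj_on_def)
      have "(\<Sum>\<^sub>\<infinity>w\<in>T - S. (cmod (y (q, n) w))\<^sup>2)
          \<le> (\<Sum>\<^sub>\<infinity>w\<in>UNIV \<times> (\<lambda>k. k + n) ` {k. int R < \<bar>k\<bar>}. (cmod (y (q, n) w))\<^sup>2)"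
      proof (rule infsum_mono2)
        \<comment> \<open>A sample outside the enlarged window is more than \<open>R\<close> away
          from every impulse time in \<open>I\<close>.\<close>
        have "k - n \<in> {k. int R < \<bar>k\<bar>}" if "(v, k) \<in> T - S" for v k
          using that \<open>n \<in> I\<close> by (auto simp: S_def I_def)
        then show "T - S \<subseteq> UNIV \<times> (\<lambda>k. k + n) ` {k. int R < \<bar>k\<bar>}"
          by (force simp: image_iff)
      qed (auto intro: y_s that)
      also have "\<dots> = (\<Sum>v\<in>UNIV. (cmod (M v q))\<^sup>2 * (\<Sum>\<^sub>\<infinity>k\<in>{k. int R < \<bar>k\<bar>}. (cmod (\<kappa> q k))\<^sup>2))"
      proof (rule infsumI)
        have "((\<lambda>k. (cmod (y (q, n) (v, k)))\<^sup>2) has_sum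
            (cmod (M v q))\<^sup>2 * (\<Sum>\<^sub>\<infinity>k\<in>{k. int R < \<bar>k\<bar>}. (cmod (\<kappa> q k))\<^sup>2)) ((\<lambda>k. k + n) ` {k. int R < \<bar>k\<bar>})" for v
          using has_sum_cmult_right[OF has_sum_infsum[OF \<kappa>_sum[OF that(1)]]]
          by (subst has_sum_reindex[OF inj]) (simp add: o_def y_def norm_mult power_mult_distrib)
        from has_sum_finite_Times[where Q = UNIV and h = "\<lambda>v k. (cmod (y (q, n) (v, k)))\<^sup>2", OF finite this]
        show "((\<lambda>w. (cmod (y (q, n) w))\<^sup>2) has_sum
            (\<Sum>v\<in>UNIV. (cmod (M v q))\<^sup>2 * (\<Sum>\<^sub>\<infinity>k\<in>{k. int R < \<bar>k\<bar>}. (cmod (\<kappa> q k))\<^sup>2)))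
            (UNIV \<times> (\<lambda>k. k + n) ` {k. int R < \<bar>k\<bar>})"
          by (simp add: case_prod_unfold)
      qed
      finally show ?thesis .
    qed
    \<comment> \<open>A finite combination of the projected impulses has, in channel
      \<open>q\<close>, the spectrum \<open>p c q\<close> cut to \<open>E q\<close>, which is the
      form on which \<open>low\<close> can be tested.\<close>
    define p where "p c q f = (\<Sum>n\<in>I. c (q, n) * cnj (cis (2 * pi * f * of_int n)))" for c :: "'q \<times> int \<Rightarrow> complex" and q f
    define P where "P c q = fourier_coeff (\<lambda>f. indicator (E q) f * p c q f)" for c q
    have p: "trig_poly (p c q)" for c q
    proof -
      have "trig_poly (\<lambda>f. \<Sum>n\<in>I. c (q, n) * cis (2 * pi * f * of_int (- n)))"
        by (intro trig_poly_sum trig_poly.monom)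
      then show ?thesis by (simp add: p_def[abs_def] cis_cnj)
    qed
    have bmP: "bounded_measurable (\<lambda>f. indicator (E q) f * p c q f)" if "q \<in> Q" for c q
      by (intro bounded_measurable_mult bmE that trig_poly_bounded_measurable p)
    have P: "P c q k = (\<Sum>n\<in>I. c (q, n) * \<kappa> q (k - n))" if "q \<in> Q" for c q k
    proof -
      have "P c q k = fourier_coeff (\<lambda>f. \<Sum>n\<in>I. c (q, n) * (indicator (E q) f * cnj (cis (2 * pi * f * of_int n)))) k"
        unfolding P_def p_def by (simp add: sum_distrib_left mult_ac)
      also have "\<dots> = (\<Sum>n\<in>I. c (q, n) * fourier_coeff (\<lambda>f. indicator (E q) f * cnj (cis (2 * pi * f * of_int n))) k)"
        by (intro fourier_coeff_sum bounded_measurable_intros E that)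
      finally show ?thesis by (simp only: fourier_coeff_shift \<kappa>_def)
    qed
    have cx: "(\<Sum>a\<in>Q \<times> I. c a * x a (q, k)) = P c q k" if "q \<in> Q" for c q k
    proof -
      have "(\<Sum>a\<in>Q \<times> I. c a * x a (q, k)) = (\<Sum>q'\<in>Q. if q = q' then (\<Sum>n\<in>I. c (q', n) * \<kappa> q' (k - n)) else 0)"
        by (subst sum.cartesian_product') (auto simp: x_def intro!: sum.cong)
      then show ?thesis using that Q by (simp add: P)
    qed
    have cy: "(\<Sum>a\<in>Q \<times> I. c a * y a (v, k)) = (\<Sum>q\<in>Q. M v q * P c q k)" for c v k
      by (subst sum.cartesian_product')
         (auto simp: y_def P sum_distrib_left mult_ac intro!: sum.cong)
    have Px: "(\<Sum>\<^sub>\<infinity>w\<in>Q \<times> UNIV. (cmod (\<Sum>a\<in>Q \<times> I. c a * x a w))\<^sup>2) = (\<Sum>q\<in>Q. \<Sum>\<^sub>\<infinity>k. (cmod (P c q k))\<^sup>2)" for c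
    proof (rule infsumI)
      have "((\<lambda>k. (cmod (\<Sum>a\<in>Q \<times> I. c a * x a (q, k)))\<^sup>2) has_sum (\<Sum>\<^sub>\<infinity>k. (cmod (P c q k))\<^sup>2)) UNIV"
        if "q \<in> Q" for q
        unfolding cx[OF that] P_def by (intro has_sum_infsum fourier_coeff_square_summable bmP that)
      from has_sum_finite_Times[where h = "\<lambda>q k. (cmod (\<Sum>a\<in>Q \<times> I. c a * x a (q, k)))\<^sup>2", OF Q this]
      show "((\<lambda>w. (cmod (\<Sum>a\<in>Q \<times> I. c a * x a w))\<^sup>2) has_sum (\<Sum>q\<in>Q. \<Sum>\<^sub>\<infinity>k. (cmod (P c q k))\<^sup>2)) (Q \<times> UNIV)"
        by (simp add: case_prod_unfold)
    qed
    \<comment> \<open>The finite set \<open>S\<close> of near samples costs its cardinality; the far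
      samples \<open>T - S\<close> enter only through their energy, which \<open>tail R\<close>
      controls.\<close>
    have energy: "(\<Sum>a\<in>Q \<times> I. \<Sum>\<^sub>\<infinity>w\<in>Q \<times> UNIV. (cmod (x a w))\<^sup>2)
        \<le> real (card S) + \<alpha> * (\<Sum>a\<in>Q \<times> I. \<Sum>\<^sub>\<infinity>w\<in>T - S. (cmod (y a w))\<^sup>2)"
    proof (rule sum_energy_le_card[OF S _ \<alpha>])
      show "finite (Q \<times> I)" using Q by (simp add: I_def)
      show "(\<lambda>w. (cmod (x a w))\<^sup>2) summable_on Q \<times> UNIV" if "a \<in> Q \<times> I" for a
        using x_hs that by (auto simp: summable_on_def)
      show "(\<lambda>w. (cmod (y a w))\<^sup>2) summable_on T - S" if "a \<in> Q \<times> I" for a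
        using y_s that by auto
      fix c
      \<comment> \<open>The Gram operator is at most one because cutting a spectrum to
        \<open>E q\<close> does not increase its energy.\<close>
      have "(\<Sum>q\<in>Q. \<Sum>\<^sub>\<infinity>k. (cmod (P c q k))\<^sup>2) \<le> (\<Sum>q\<in>Q. \<Sum>n\<in>I. (cmod (c (q, n)))\<^sup>2)"
      proof (rule sum_mono)
        fix q assume q: "q \<in> Q"
        have "(\<Sum>\<^sub>\<infinity>k. (cmod (P c q k))\<^sup>2) \<le> (LINT f|period. (cmod (indicator (E q) f * p c q f))\<^sup>2)"
          unfolding P_def by (rule bessel[OF bmP[OF q]])
        also have "\<dots> \<le> (LINT f|period. (cmod (p c q f))\<^sup>2)"
          by (intro integral_mono integrable_bounded_measurable bmP q trig_poly_bounded_measurable p)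
             (auto simp: indicator_def)
        also have "\<dots> = (\<Sum>n\<in>I. (cmod (c (q, n)))\<^sup>2)"
          unfolding p_def by (rule integral_trig_square) (simp add: I_def)
        finally show "(\<Sum>\<^sub>\<infinity>k. (cmod (P c q k))\<^sup>2) \<le> (\<Sum>n\<in>I. (cmod (c (q, n)))\<^sup>2)" .
      qed
      then show "(\<Sum>\<^sub>\<infinity>w\<in>Q \<times> UNIV. (cmod (\<Sum>a\<in>Q \<times> I. c a * x a w))\<^sup>2) \<le> (\<Sum>a\<in>Q \<times> I. (cmod (c a))\<^sup>2)"
        unfolding Px unfolding sum.cartesian_product' .
      have yT: "(\<lambda>w. (cmod (\<Sum>a\<in>Q \<times> I. c a * y a w))\<^sup>2) summable_on A" for A
        by (intro summable_on_square_sum) (auto intro: y_s)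
      have "(\<Sum>\<^sub>\<infinity>w\<in>Q \<times> UNIV. (cmod (\<Sum>a\<in>Q \<times> I. c a * x a w))\<^sup>2)
          \<le> \<alpha> * (\<Sum>\<^sub>\<infinity>(v, k)\<in>T. (cmod (\<Sum>q\<in>Q. M v q * P c q k))\<^sup>2)"
        unfolding Px unfolding P_def by (rule low) (rule p)
      also have "(\<Sum>\<^sub>\<infinity>(v, k)\<in>T. (cmod (\<Sum>q\<in>Q. M v q * P c q k))\<^sup>2)
          = (\<Sum>\<^sub>\<infinity>w\<in>S \<union> (T - S). (cmod (\<Sum>a\<in>Q \<times> I. c a * y a w))\<^sup>2)"
        by (rule infsum_cong_neutral) (auto simp: cy S_def)
      also have "\<dots> = (\<Sum>s\<in>S. (cmod (\<Sum>a\<in>Q \<times> I. c a * y a s))\<^sup>2)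
          + (\<Sum>\<^sub>\<infinity>s\<in>T - S. (cmod (\<Sum>a\<in>Q \<times> I. c a * y a s))\<^sup>2)"
        using S by (subst infsum_Un_disjoint) (auto intro: yT)
      finally show "(\<Sum>\<^sub>\<infinity>w\<in>Q \<times> UNIV. (cmod (\<Sum>a\<in>Q \<times> I. c a * x a w))\<^sup>2)
          \<le> \<alpha> * ((\<Sum>s\<in>S. (cmod (\<Sum>a\<in>Q \<times> I. c a * y a s))\<^sup>2)
          + (\<Sum>\<^sub>\<infinity>s\<in>T - S. (cmod (\<Sum>a\<in>Q \<times> I. c a * y a s))\<^sup>2))" .
    qed
    \<comment> \<open>The trace: each of the \<open>2 * N + 1\<close> impulse times contributes the
      measure of every band once.\<close>
    have near: "(\<Sum>a\<in>Q \<times> I. \<Sum>\<^sub>\<infinity>w\<in>Q \<times> UNIV. (cmod (x a w))\<^sup>2) = (2 * real N + 1) * D"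
    proof -
      have "(\<Sum>a\<in>Q \<times> I. \<Sum>\<^sub>\<infinity>w\<in>Q \<times> UNIV. (cmod (x a w))\<^sup>2) = (\<Sum>(q, n)\<in>Q \<times> I. measure lebesgue (E q))"
        by (intro sum.cong) (auto intro: infsumI x_hs)
      also have "\<dots> = (2 * real N + 1) * D"
        by (subst sum.cartesian_product') (simp add: cardI D_def sum_distrib_left)
      finally show ?thesis .
    qed
    have far: "(\<Sum>a\<in>Q \<times> I. \<Sum>\<^sub>\<infinity>w\<in>T - S. (cmod (y a w))\<^sup>2) \<le> (2 * real N + 1) * tail R"
    proof -
      have "(\<Sum>a\<in>Q \<times> I. \<Sum>\<^sub>\<infinity>w\<in>T - S. (cmod (y a w))\<^sup>2)
          \<le> (\<Sum>(q, n)\<in>Q \<times> I. \<Sum>v\<in>UNIV. (cmod (M v q))\<^sup>2 * (\<Sum>\<^sub>\<infinity>k\<in>{k. int R < \<bar>k\<bar>}. (cmod (\<kappa> q k))\<^sup>2))"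
        by (intro sum_mono) (auto intro: y_far)
      also have "\<dots> = (2 * real N + 1) * tail R"
        by (subst sum.cartesian_product') (simp add: cardI tail_def sum_distrib_left)
      finally show ?thesis .
    qed
    show ?thesis
      using energy mult_left_mono[OF far \<alpha>] unfolding near S_def by (simp add: algebra_simps)
  qed
  have "tail \<longlonglongrightarrow> (\<Sum>q\<in>Q. \<Sum>v\<in>UNIV. (cmod (M v q))\<^sup>2 * 0)"
    unfolding tail_def by (intro tendsto_intros infsum_tail_tendsto \<kappa>_sum) auto
  then have tail0: "tail \<longlonglongrightarrow> 0" by simp
  have bound: "ereal (D - \<alpha> * tail R)
      \<le> liminf (\<lambda>n::nat. ereal (real (card (T \<inter> (UNIV \<times> {-int n..int n}))) / (2 * real n)))" for R
  proof -
    define d where "d = D - \<alpha> * tail R"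
    \<comment> \<open>\<open>b n\<close> is \<open>(2 * (n - R) + 1) * d / (2 * n)\<close>, the
      count for \<open>N = n - R\<close> divided by the normalisation of the ratio and written so
      that its limit \<open>d\<close> is visible.\<close>
    define b where "b n = d + (1 - 2 * real R) * d / 2 / real n" for n :: nat
    have "b \<longlonglongrightarrow> d + 0"
      unfolding b_def by (intro tendsto_intros lim_const_over_n)
    then have "(\<lambda>n. ereal (b n)) \<longlonglongrightarrow> ereal d" by simp
    then have "ereal d = liminf (\<lambda>n. ereal (b n))"
      by (rule lim_imp_Liminf[OF sequentially_bot, symmetric])
    also have "\<dots> \<le> liminf (\<lambda>n::nat. ereal (real (card (T \<inter> (UNIV \<times> {-int n..int n}))) / (2 * real n)))"
    proof (rule Liminf_mono, rule eventually_sequentiallyI[of "R + 1"])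
      fix n assume n: "R + 1 \<le> n"
      have "(2 * real (n - R) + 1) * d \<le> real (card (T \<inter> (UNIV \<times> {-int n..int n})))"
        using count[of "n - R" R] n by (simp add: d_def)
      moreover have "b n * (2 * real n) = (2 * real (n - R) + 1) * d"
        using n by (simp add: b_def field_simps of_nat_diff)
      ultimately show "ereal (b n) \<le> ereal (real (card (T \<inter> (UNIV \<times> {-int n..int n}))) / (2 * real n))"
        using n by (simp add: pos_le_divide_eq)
    qed
    finally show ?thesis by (simp add: d_def)
  qed
  have "(\<lambda>R. D - \<alpha> * tail R) \<longlonglongrightarrow> D - \<alpha> * 0"
    by (intro tendsto_intros tail0)
  then have "(\<lambda>R. ereal (D - \<alpha> * tail R)) \<longlonglongrightarrow> ereal D" by simp
  then show ?thesis unfolding D_def[symmetric]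
    by (rule LIMSEQ_le_const2) (use bound in blast)
qed

subsection \<open>Rank, kernels and orthonormal bases\<close>

text \<open>The kernel of the submatrix \<open>U(D, A)\<close>, extended by zero outside
  \<open>A\<close> so that the kernels for all \<open>A\<close> lie in one vector space.\<close>

definition masked_kernel :: "real^'i^'v \<Rightarrow> 'v set \<Rightarrow> 'i set \<Rightarrow> (real^'i) set" where
  "masked_kernel U D A = {c. (\<forall>i. i \<notin> A \<longrightarrow> c $ i = 0) \<and> (\<forall>v\<in>D. (U *v c) $ v = 0)}"

lemma subspace_masked_kernel: "subspace (masked_kernel U D A)"
  by (auto simp: subspace_def masked_kernel_def matrix_vector_right_distrib matrix_vector_mult_scaleR)

text \<open>Rank-nullity for the submatrix: within the coordinate subspace of \<open>A\<close>, of
  dimension \<open>card A\<close>, the kernel is the orthogonal complement of the span of the masked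
  rows.\<close>

lemma dim_masked_kernel:
  fixes U :: "real^'i::finite^'v::finite"
  shows "dim (masked_kernel U D A) + subrank U D A = card A"
proof -
  define M where "M = (\<chi> v i. if v \<in> D \<and> i \<in> A then U $ v $ i else 0)"
  define B where "B = {c :: real^'i. \<forall>i. i \<notin> A \<longrightarrow> c $ i = 0}"
  have B: "subspace B" by (auto simp: B_def subspace_def)
  have "rows M \<subseteq> B" by (auto simp: rows_def row_def M_def B_def)
  then have "span (rows M) \<subseteq> B" using B span_minimal by blast
  then have "dim {y \<in> B. \<forall>x\<in>span (rows M). orthogonal x y} + dim (span (rows M)) = dim B"
    by (intro dim_subspace_orthogonal_to_vectors subspace_span B)
  moreover have "{y \<in> B. \<forall>x\<in>span (rows M). orthogonal x y} = masked_kernel U D A"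
  proof -
    have "(\<forall>x\<in>span (rows M). orthogonal x y) \<longleftrightarrow> (\<forall>x\<in>rows M. orthogonal x y)" for y
    proof (intro iffI ballI)
      fix x assume "x \<in> span (rows M)" "\<forall>x\<in>rows M. orthogonal x y"
      then have "orthogonal y x"
        by (intro orthogonal_to_span[of x "rows M" y]) (auto simp: orthogonal_commute)
      then show "orthogonal x y" by (simp add: orthogonal_commute)
    qed (simp add: span_base)
    moreover have "(\<forall>x\<in>rows M. orthogonal x y) \<longleftrightarrow> (\<forall>v\<in>D. (U *v y) $ v = 0)" if "y \<in> B" for y
    proof -
      have "row v M \<bullet> y = (if v \<in> D then (U *v y) $ v else 0)" for v
        using that by (auto simp: row_def M_def inner_vec_def matrix_vector_mult_def B_def intro!: sum.cong)
      moreover have "rows M = range (\<lambda>v. row v M)" by (auto simp: rows_def)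
      ultimately show ?thesis by (auto simp: orthogonal_def split: if_splits)
    qed
    ultimately show ?thesis by (auto simp: masked_kernel_def B_def)
  qed
  moreover have "dim B = card A"
    unfolding B_def using dim_substandard_cart[where d = A and 'a = real and 'n = 'i] by (simp only: dim_vec_eq)
  ultimately show ?thesis
    by (simp add: subrank_def M_def[symmetric] row_rank_def)
qed

text \<open>Full column rank leaves only the zero vector in the kernel, and an injective linear map
  on a finite-dimensional space is bounded below. As \<open>U\<close> is real, complex coefficients
  follow from their real and imaginary parts.\<close>

lemma full_rank_bounded_below:
  fixes U :: "real^'i::finite^'v::finite"
  assumes "subrank U D A = card A"
  obtains \<delta> where "\<delta> > 0" "\<And>c :: 'i \<Rightarrow> complex. (\<And>i. i \<notin> A \<Longrightarrow> c i = 0) \<Longrightarrow>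
    \<delta> * (\<Sum>i\<in>UNIV. (cmod (c i))\<^sup>2) \<le> (\<Sum>v\<in>D. (cmod (\<Sum>i\<in>UNIV. of_real (U $ v $ i) * c i))\<^sup>2)"
proof -
  define M where "M = (\<chi> v i. if v \<in> D then U $ v $ i else 0)"
  define B where "B = {c :: real^'i. \<forall>i. i \<notin> A \<longrightarrow> c $ i = 0}"
  have B: "subspace B" by (auto simp: B_def subspace_def)
  have Mv: "(M *v c) $ v = (if v \<in> D then (U *v c) $ v else 0)" for c v
    by (simp add: M_def matrix_vector_mult_def)
  have "dim (masked_kernel U D A) = 0" using dim_masked_kernel[of U D A] assms by simp
  then have "masked_kernel U D A \<subseteq> {0}" by (simp add: dim_eq_0)
  then have "\<forall>c\<in>B. M *v c = 0 \<longrightarrow> c = 0"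
    by (auto simp: masked_kernel_def B_def vec_eq_iff Mv)
  then obtain e where e: "e > 0" "\<And>c. c \<in> B \<Longrightarrow> e * norm c \<le> norm (M *v c)"
    using injective_imp_isometric[OF closed_subspace[OF B] B matrix_vector_mul_bounded_linear[of M]] by auto
  have norm_sq: "(norm c)\<^sup>2 = (\<Sum>i\<in>UNIV. (c $ i)\<^sup>2)" for c :: "real^'n::finite"
    by (simp add: norm_vec_def L2_set_def sum_nonneg)
  have real: "e\<^sup>2 * (\<Sum>i\<in>UNIV. (c i)\<^sup>2) \<le> (\<Sum>v\<in>D. (\<Sum>i\<in>UNIV. U $ v $ i * c i)\<^sup>2)"
    if "\<And>i. i \<notin> A \<Longrightarrow> c i = 0" for c :: "'i \<Rightarrow> real"
  proof -
    define d where "d = (\<chi> i. c i)"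
    have "d \<in> B" using that by (auto simp: B_def d_def)
    then have "(e * norm d)\<^sup>2 \<le> (norm (M *v d))\<^sup>2"
      using e by (intro power_mono) auto
    also have "(norm (M *v d))\<^sup>2 = (\<Sum>v\<in>D. (\<Sum>i\<in>UNIV. U $ v $ i * c i)\<^sup>2)"
      unfolding norm_sq Mv
      by (simp add: if_distrib[of "\<lambda>t. t\<^sup>2"] sum.If_cases matrix_vector_mult_def d_def cong: if_cong)
    finally show ?thesis by (simp add: power_mult_distrib norm_sq d_def)
  qed
  show ?thesis
  proof
    show "e\<^sup>2 > 0" using e by simp
    fix c :: "'i \<Rightarrow> complex" assume c: "\<And>i. i \<notin> A \<Longrightarrow> c i = 0"
    have "e\<^sup>2 * (\<Sum>i\<in>UNIV. (cmod (c i))\<^sup>2)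
        = e\<^sup>2 * (\<Sum>i\<in>UNIV. (Re (c i))\<^sup>2) + e\<^sup>2 * (\<Sum>i\<in>UNIV. (Im (c i))\<^sup>2)"
      by (simp add: cmod_power2 sum.distrib distrib_left)
    also have "\<dots> \<le> (\<Sum>v\<in>D. (\<Sum>i\<in>UNIV. U $ v $ i * Re (c i))\<^sup>2)
        + (\<Sum>v\<in>D. (\<Sum>i\<in>UNIV. U $ v $ i * Im (c i))\<^sup>2)"
      using c by (intro add_mono real) auto
    also have "\<dots> = (\<Sum>v\<in>D. (cmod (\<Sum>i\<in>UNIV. of_real (U $ v $ i) * c i))\<^sup>2)"
      by (simp add: cmod_power2 sum.distrib)
    finally show "e\<^sup>2 * (\<Sum>i\<in>UNIV. (cmod (c i))\<^sup>2)
        \<le> (\<Sum>v\<in>D. (cmod (\<Sum>i\<in>UNIV. of_real (U $ v $ i) * c i))\<^sup>2)" .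
  qed
qed

text \<open>Real orthonormal vectors stay orthonormal over the complex numbers, so bases of the real
  kernels serve for complex spectra.\<close>

lemma orthonormal_sum_square:
  fixes B :: "(real^'i::finite) set" and z :: "real^'i \<Rightarrow> complex"
  assumes "finite B" "pairwise orthogonal B" "\<And>b. b \<in> B \<Longrightarrow> norm b = 1"
  shows "(\<Sum>i\<in>UNIV. (cmod (\<Sum>b\<in>B. of_real (b $ i) * z b))\<^sup>2) = (\<Sum>b\<in>B. (cmod (z b))\<^sup>2)"
proof -
  have ip: "(\<Sum>i\<in>UNIV. complex_of_real (b $ i) * of_real (b' $ i)) = (if b = b' then 1 else 0)"
    if "b \<in> B" "b' \<in> B" for b b'
  proof -
    have "(\<Sum>i\<in>UNIV. complex_of_real (b $ i) * of_real (b' $ i)) = of_real (b \<bullet> b')"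
      by (simp add: inner_vec_def)
    also have "b \<bullet> b' = (if b = b' then 1 else 0)"
      using assms(2,3) that by (auto simp: pairwise_def orthogonal_def norm_eq_1)
    finally show ?thesis by simp
  qed
  have "complex_of_real (\<Sum>i\<in>UNIV. (cmod (\<Sum>b\<in>B. of_real (b $ i) * z b))\<^sup>2)
      = (\<Sum>i\<in>UNIV. \<Sum>b\<in>B. \<Sum>b'\<in>B. (z b * cnj (z b')) * (of_real (b $ i) * of_real (b' $ i)))"
    unfolding of_real_sum complex_norm_square by (simp add: sum_product mult_ac)
  also have "\<dots> = (\<Sum>b\<in>B. \<Sum>b'\<in>B. \<Sum>i\<in>UNIV. (z b * cnj (z b')) * (of_real (b $ i) * of_real (b' $ i)))"
    by (subst sum.swap, intro sum.cong refl, subst sum.swap, simp)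
  also have "\<dots> = (\<Sum>b\<in>B. \<Sum>b'\<in>B. z b * cnj (z b') * (if b = b' then 1 else 0))"
    by (simp only: sum_distrib_left[symmetric]) (simp add: ip cong: sum.cong)
  also have "\<dots> = (\<Sum>b\<in>B. z b * cnj (z b))"
    using assms(1) by (simp add: if_distrib cong: if_cong)
  also have "\<dots> = complex_of_real (\<Sum>b\<in>B. (cmod (z b))\<^sup>2)"
    unfolding of_real_sum complex_norm_square ..
  finally show ?thesis unfolding of_real_eq_iff .
qed

lemma finite_union_of_intervals_lmeasurable:
  assumes "finite_union_of_intervals A" "bounded A"
  shows "A \<in> lmeasurable"
proof -
  obtain \<C> where \<C>: "finite \<C>" "\<And>C. C \<in> \<C> \<Longrightarrow> is_interval C" "A = \<Union>\<C>"
    using assms(1) unfolding finite_union_of_intervals_def by blast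
  have "C \<in> sets lebesgue" if "C \<in> \<C>" for C
    using that \<C> assms(2)
    by (intro fmeasurableD measurable_convex is_interval_convex) (auto intro: bounded_subset)
  then have "A \<in> sets lebesgue" unfolding \<C>(3) using \<C>(1) by (intro sets.finite_Union) auto
  then show ?thesis using assms(2) by (rule bounded_set_imp_lmeasurable[rotated])
qed

lemma fourier_coeff_dtft:
  assumes "bounded_measurable g"
  shows "dtft_is (fourier_coeff g) g"
  unfolding dtft_is_def
proof (intro conjI allI)
  show "g measurable_on {-1/2..1/2}"
    using assms by (simp add: measurable_on_iff_borel_measurable bounded_measurable_def)
  show "(\<lambda>f. (cmod (g f))\<^sup>2) integrable_on {-1/2..1/2}"
    using integrable_bounded_measurable(2)[OF assms] by (intro integrable_on_lebesgue_on) auto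
  show "fourier_coeff g n = integral {-1/2..1/2} (\<lambda>f. g f * cis (2 * pi * f * real_of_int n))" for n
    unfolding fourier_coeff_def
    by (intro lebesgue_integral_eq_integral integrable_bounded_measurable(1) bounded_measurable_intros assms) auto
qed

subsection \<open>The sampling ratio bound\<close>

theorem theorem3:
  fixes W :: "real^'v::finite^'v"
    and U :: "real^'i::finite^'v"
    and F :: "'i \<Rightarrow> real set"
    and S'G :: "'v set"
    and S :: "('v \<times> int) set"
    and \<Theta> :: "'v set"
  assumes graph: "undirected_graph_weights W"
    and U: "laplacian_eigvec_matrix W U"
    and F_sub: "\<And>i. F i \<subseteq> {-1/2..<1/2}"
    and F_int: "\<And>i. finite_union_of_intervals (F i)"
    and S'G_card: "card S'G = card {i. F i \<noteq> {}}"
    and S'G_rank: "subrank U S'G {i. F i \<noteq> {}} = card {i. F i \<noteq> {}}"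
    and S_sub: "S \<subseteq> S'G \<times> UNIV"
    and stable: "stable_sampling S S'G (BL_D U F)"
    and Theta: "\<Theta> \<subseteq> S'G" "\<Theta> \<noteq> {}"
  shows "sampling_ratio {(v, n) \<in> S. v \<in> \<Theta>} \<Theta> \<ge>
     ereal ((1 / real (card \<Theta>)) *
       ((\<Sum>i\<in>UNIV. measure lebesgue (F i)) -
        integral (\<Union>i. F i) (\<lambda>f. real (subrank U (S'G - \<Theta>) {i. f \<in> F i}))))"
proof -
  define T where "T = {(v, n) \<in> S. v \<in> \<Theta>}"
  \<comment> \<open>The frequencies whose active set is exactly \<open>A\<close>. These finitely
    many sets partition the period, and everything that depends on the active set is constant on
    each.\<close>
  define G where "G A = {f \<in> {-1/2..<1/2}. {i. f \<in> F i} = A}" for A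
  define r where "r A = subrank U (S'G - \<Theta>) A" for A
  define N where "N A = masked_kernel U (S'G - \<Theta>) A" for A
  have Fm: "F i \<in> lmeasurable" for i
    using F_int F_sub by (rule finite_union_of_intervals_lmeasurable[OF _ bounded_subset[rotated]]) auto
  have Gm: "G A \<in> lmeasurable" for A
  proof -
    have "G A = {-1/2..<1/2} \<inter> (\<Inter>i. if i \<in> A then F i else - F i)"
      unfolding G_def by (auto split: if_splits)
    moreover have "(if i \<in> A then F i else - F i) \<in> sets lebesgue" for i
      using fmeasurableD[OF Fm, of i] by (simp add: Compl_in_sets_lebesgue)
    then have "{-1/2..<1/2} \<inter> (\<Inter>i. if i \<in> A then F i else - F i) \<in> sets lebesgue"
      by (intro sets.Int sets.finite_INT) simp_all
    ultimately have "G A \<in> sets lebesgue" by (simp only:)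
    moreover have "bounded (G A)" by (rule bounded_subset[of "{-1/2..1/2}"]) (auto simp: G_def)
    ultimately show ?thesis by (intro bounded_set_imp_lmeasurable)
  qed

  \<comment> \<open>Frequency integrals as finite sums over active sets\<close>
  have integral_G: "((\<lambda>f. \<Sum>A\<in>UNIV. w A * indicator (G A) f) has_integral (\<Sum>A\<in>UNIV. w A * measure lebesgue (G A))) UNIV"
    for w :: "'i set \<Rightarrow> real"
    using Gm by (intro has_integral_sum has_integral_mult_right) (auto simp: lmeasurable_iff_has_integral)
  have sum_G: "(\<Sum>A\<in>UNIV. w A * indicator (G A) f)
      = (if f \<in> {-1/2..<1/2} then w {i. f \<in> F i} else 0)" for w :: "'i set \<Rightarrow> real" and f
  proof -
    have "(\<Sum>A\<in>UNIV. w A * indicator (G A) f)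
        = (\<Sum>A\<in>UNIV. if A = {i. f \<in> F i} then (if f \<in> {-1/2..<1/2} then w A else 0) else 0)"
      by (intro sum.cong) (auto simp: G_def indicator_def)
    then show ?thesis by simp
  qed
  have measure_F: "measure lebesgue (F i) = (\<Sum>A\<in>UNIV. of_bool (i \<in> A) * measure lebesgue (G A))" for i
  proof (rule has_integral_unique)
    show "(indicat_real (F i) has_integral measure lebesgue (F i)) UNIV"
      using Fm lmeasurable_iff_has_integral by blast
    have "indicat_real (F i) = (\<lambda>f. \<Sum>A\<in>UNIV. of_bool (i \<in> A) * indicator (G A) f)"
      unfolding sum_G using F_sub[of i] by (auto simp: fun_eq_iff indicator_def)
    then show "(indicat_real (F i) has_integral (\<Sum>A\<in>UNIV. of_bool (i \<in> A) * measure lebesgue (G A))) UNIV"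
      by (simp only: integral_G)
  qed
  have r_dim: "real (r A) = real (card A) - real (dim (N A))" for A
    using dim_masked_kernel[of U "S'G - \<Theta>" A] unfolding r_def N_def by linarith
  \<comment> \<open>The integral runs over the union of the supports only, while the sum over all
    \<open>A\<close> also includes the frequencies in \<open>G {}\<close>; they must contribute
    0.\<close>
  have "r {} = 0" using dim_masked_kernel[of U "S'G - \<Theta>" "{}"] by (simp add: r_def)
  have integral_r: "integral (\<Union>i. F i) (\<lambda>f. real (r {i. f \<in> F i})) = (\<Sum>A\<in>UNIV. real (r A) * measure lebesgue (G A))"
  proof -
    have "(if f \<in> (\<Union>i. F i) then real (r {i. f \<in> F i}) else 0) = (\<Sum>A\<in>UNIV. real (r A) * indicator (G A) f)" for f
    proof (cases "f \<in> (\<Union>i. F i)")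
      case True
      then have "f \<in> {-1/2..<1/2}" using F_sub by blast
      then show ?thesis unfolding sum_G using True by simp
    next
      case False
      then have "{i. f \<in> F i} = {}" by auto
      then show ?thesis unfolding sum_G using False \<open>r {} = 0\<close> by simp
    qed
    then have "integral UNIV (\<lambda>f. if f \<in> (\<Union>i. F i) then real (r {i. f \<in> F i}) else 0)
        = (\<Sum>A\<in>UNIV. real (r A) * measure lebesgue (G A))"
      using integral_G[of "\<lambda>A. real (r A)"] by (simp only: integral_unique)
    then show ?thesis by (simp only: integral_restrict_UNIV)
  qed
  \<comment> \<open>Double counting: the piece \<open>G A\<close> is counted once for every index in
    \<open>A\<close>.\<close>
  have "(\<Sum>i\<in>UNIV. measure lebesgue (F i)) = (\<Sum>A\<in>UNIV. real (card A) * measure lebesgue (G A))"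
    unfolding measure_F
    by (subst sum.swap) (simp flip: sum_distrib_right)
  then have deficit: "(\<Sum>i\<in>UNIV. measure lebesgue (F i)) - integral (\<Union>i. F i) (\<lambda>f. real (r {i. f \<in> F i}))
      = (\<Sum>A\<in>UNIV. real (dim (N A)) * measure lebesgue (G A))"
    unfolding integral_r unfolding r_dim by (simp add: left_diff_distrib sum_subtractf)

  \<comment> \<open>Splitting the signals that vanish off \<Theta> into scalar channels\<close>
  have "\<exists>B. B \<subseteq> N A \<and> pairwise orthogonal B \<and> (\<forall>b\<in>B. norm b = 1) \<and> finite B \<and> card B = dim (N A)" for A
    unfolding N_def
    by (rule orthonormal_basis_subspace[OF subspace_masked_kernel[of U "S'G - \<Theta>" A]])
       (metis independent_imp_finite)
  then obtain B where B: "\<And>A. B A \<subseteq> N A" "\<And>A. pairwise orthogonal (B A)"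
    "\<And>A b. b \<in> B A \<Longrightarrow> norm b = 1" "\<And>A. finite (B A)" "\<And>A. card (B A) = dim (N A)"
    by metis
  \<comment> \<open>Signals vanishing on the complement of \<^term>\<open>\<Theta>\<close> have, at a frequency with active set \<^term>\<open>A\<close>,
    coefficients in \<^term>\<open>N A\<close>; each basis vector contributes one scalar channel with spectrum \<^term>\<open>G A\<close>.\<close>
  define Q where "Q = (SIGMA A:UNIV. B A)"
  have Q: "finite Q" unfolding Q_def using B(4) by auto
  have sum_Q: "(\<Sum>q\<in>Q. h q) = (\<Sum>A\<in>UNIV. \<Sum>b\<in>B A. h (A, b))"
    for h :: "'i set \<times> (real^'i) \<Rightarrow> 'x::comm_monoid_add"
    unfolding Q_def using B(4) by (subst sum.Sigma) auto
  define E where "E q = G (fst q)" for q :: "'i set \<times> (real^'i)"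
  define M where "M v q = complex_of_real ((U *v snd q) $ v)" for v and q :: "'i set \<times> (real^'i)"
  have Q_kernel: "(i \<notin> fst q \<longrightarrow> snd q $ i = 0) \<and> (v \<in> S'G - \<Theta> \<longrightarrow> (U *v snd q) $ v = 0)"
    if "q \<in> Q" for q i v
    using that B(1)[of "fst q"] by (force simp: Q_def N_def masked_kernel_def)
  have E_sub: "E q \<subseteq> {-1/2..1/2}" for q by (auto simp: E_def G_def)
  have density: "(\<Sum>q\<in>Q. measure lebesgue (E q)) = (\<Sum>A\<in>UNIV. real (dim (N A)) * measure lebesgue (G A))"
    by (simp add: sum_Q E_def B(5))

  have UU: "(\<Sum>v\<in>UNIV. U $ v $ i * U $ v $ j) = (if i = j then 1 else 0)" for i j
  proof -
    have "(transpose U ** U) $ i $ j = mat 1 $ i $ j" using U by (simp add: laplacian_eigvec_matrix_def)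
    then show ?thesis by (simp add: matrix_matrix_mult_def transpose_def mat_def)
  qed
  \<comment> \<open>The quantitative form of the rank condition: a spectrum on the active indices is
    controlled by its values at the vertices in \<open>S'G\<close>.\<close>
  obtain \<delta> where \<delta>: "\<delta> > 0" "\<And>c :: 'i \<Rightarrow> complex. (\<And>i. F i = {} \<Longrightarrow> c i = 0) \<Longrightarrow>
    \<delta> * (\<Sum>i\<in>UNIV. (cmod (c i))\<^sup>2) \<le> (\<Sum>v\<in>S'G. (cmod (\<Sum>i\<in>UNIV. of_real (U $ v $ i) * c i))\<^sup>2)"
    using full_rank_bounded_below[OF S'G_rank] by auto
  obtain a where a: "a > 0" "\<And>X. X \<in> BL_D U F \<Longrightarrow> a * sq_norm_on S'G X \<le> sample_energy S X"
    using stable unfolding stable_sampling_def by blast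

  \<comment> \<open>The frame inequality for the channels\<close>
  have "ereal (\<Sum>q\<in>Q. measure lebesgue (E q))
    \<le> liminf (\<lambda>n::nat. ereal (real (card (T \<inter> (UNIV \<times> {-int n..int n}))) / (2 * real n)))"
  proof (rule density_lower_bound[OF Q _ E_sub, where \<alpha> = "1 / (\<delta> * a)" and M = M])
    show "E q \<in> sets lebesgue" for q using Gm by (auto simp: E_def)
    show "0 \<le> 1 / (\<delta> * a)" using \<delta>(1) a(1) by simp
    fix p :: "'i set \<times> (real^'i) \<Rightarrow> real \<Rightarrow> complex" assume p: "\<And>q. trig_poly (p q)"
    define c where "c q = fourier_coeff (\<lambda>f. indicator (E q) f * p q f)" for q
    \<comment> \<open>\<open>g\<close> assembles the channel spectra into JFT rows; on
      \<open>G A\<close> the vector of rows is a complex combination of the basis of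
      \<open>N A\<close>. \<open>X\<close> is the signal with these rows.\<close>
    define g where "g i f = (\<Sum>q\<in>Q. of_real (snd q $ i) * (indicator (E q) f * p q f))" for i f
    define X where "X v k = (\<Sum>i\<in>UNIV. of_real (U $ v $ i) * fourier_coeff (g i) k)" for v k
    have bm: "bounded_measurable (\<lambda>f. indicator (E q) f * p q f)" for q
      using Gm by (intro bounded_measurable_intros trig_poly_bounded_measurable p) (auto simp: E_def)
    have g_approx: "trig_approximable (g i)" for i
    proof -
      have "trig_approximable (\<lambda>f. \<Sum>q\<in>Q. indicator (E q) f * (of_real (snd q $ i) * p q f))"
        using Gm by (intro trig_approximable_sum trig_approximable_mult trig_approximable_indicator
            trig_poly_mult trig_poly_const p) (auto simp: E_def)
      then show ?thesis by (simp add: g_def[abs_def] mult.left_commute)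
    qed
    then have g_bm: "bounded_measurable (g i)" for i using trig_approximable_def by blast
    have g_c: "fourier_coeff (g i) k = (\<Sum>q\<in>Q. of_real (snd q $ i) * c q k)" for i k
      unfolding g_def c_def by (rule fourier_coeff_sum[OF bm])
    \<comment> \<open>On the band of \<open>q\<close> the active set is \<open>fst q\<close>, so
      \<open>f\<close> outside \<open>F i\<close> puts \<open>i\<close> outside
      \<open>fst q\<close>, where the basis vector \<open>snd q\<close> vanishes.\<close>
    have g_supp: "g i f = 0" if "f \<notin> F i" for i f
      unfolding g_def
    proof (rule sum.neutral, rule ballI)
      fix q assume "q \<in> Q"
      then have "snd q $ i = 0" if "f \<in> E q"
        using that \<open>f \<notin> F i\<close> Q_kernel[of q i] by (auto simp: E_def G_def)
      then show "of_real (snd q $ i) * (indicator (E q) f * p q f) = 0"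
        by (auto simp: indicator_def)
    qed
    have X_c: "X v k = (\<Sum>q\<in>Q. M v q * c q k)" for v k
      unfolding X_def g_c M_def matrix_vector_mult_def
      by (simp add: sum_distrib_left sum_distrib_right mult.assoc) (subst sum.swap, simp)
    have X_coeff: "X v = fourier_coeff (\<lambda>f. \<Sum>i\<in>UNIV. of_real (U $ v $ i) * g i f)" for v
      unfolding X_def by (rule ext) (rule fourier_coeff_sum[OF g_bm, symmetric])
    have X_sum: "(\<lambda>k. (cmod (X v k))\<^sup>2) summable_on A" for v A
      unfolding X_coeff by (intro fourier_coeff_square_summable bounded_measurable_intros g_bm)
    have "X \<in> BL_D U F"
      unfolding BL_D_def dtvgs_def
    proof (intro CollectI conjI allI X_sum)
      fix i
      \<comment> \<open>Orthonormality of the columns of \<open>U\<close> inverts the synthesis and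
        returns row \<open>i\<close>.\<close>
      have "(\<Sum>v\<in>UNIV. complex_of_real (U $ v $ i) * X v k) = fourier_coeff (g i) k" for k
      proof -
        have "(\<Sum>v\<in>UNIV. complex_of_real (U $ v $ i) * X v k)
            = (\<Sum>j\<in>UNIV. of_real (\<Sum>v\<in>UNIV. U $ v $ i * U $ v $ j) * fourier_coeff (g j) k)"
          unfolding X_def
          by (simp add: sum_distrib_left sum_distrib_right mult.assoc) (subst sum.swap, simp)
        then show ?thesis by (simp add: UU if_distrib[of of_real] if_distrib[of "\<lambda>t. t * _"] cong: if_cong)
      qed
      then have "dtft_is (\<lambda>k. \<Sum>v\<in>UNIV. complex_of_real (U $ v $ i) * X v k) (g i)"
        using fourier_coeff_dtft[OF g_bm[of i]] by simp
      then show "\<exists>Y. dtft_is (\<lambda>k. \<Sum>v\<in>UNIV. complex_of_real (U $ v $ i) * X v k) Y \<and>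
          (\<forall>f\<in>{-1/2..<1/2} - F i. Y f = 0)"
        using g_supp by blast
    qed
    \<comment> \<open>At one frequency only the channels of its own active set are alive, and their
      vectors form an orthonormal family.\<close>
    have pointwise: "(\<Sum>i\<in>UNIV. (cmod (g i f))\<^sup>2) = (\<Sum>q\<in>Q. (cmod (indicator (E q) f * p q f))\<^sup>2)" for f
    proof -
      define A where "A = {i. f \<in> F i}"
      have single: "(\<Sum>q\<in>Q. h q) = (\<Sum>b\<in>B A. h (A, b))"
        if "\<And>A' b. A' \<noteq> A \<Longrightarrow> h (A', b) = 0" for h :: "'i set \<times> (real^'i) \<Rightarrow> 'x::comm_monoid_add"
      proof -
        have "(\<Sum>q\<in>Q. h q) = (\<Sum>A'\<in>{A}. \<Sum>b\<in>B A'. h (A', b))"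
          unfolding sum_Q using that by (intro sum.mono_neutral_right) auto
        then show ?thesis by simp
      qed
      have off: "indicator (E (A', b)) f = 0" if "A' \<noteq> A" for A' b
        using that by (auto simp: E_def G_def A_def indicator_def)
      have "g i f = (\<Sum>b\<in>B A. of_real (b $ i) * (indicator (E (A, b)) f * p (A, b) f))" for i
        unfolding g_def by (subst single) (auto simp: off)
      then have "(\<Sum>i\<in>UNIV. (cmod (g i f))\<^sup>2) = (\<Sum>b\<in>B A. (cmod (indicator (E (A, b)) f * p (A, b) f))\<^sup>2)"
        using orthonormal_sum_square[OF B(4) B(2) B(3), where z = "\<lambda>b. indicator (E (A, b)) f * p (A, b) f"]
        by simp
      also have "\<dots> = (\<Sum>q\<in>Q. (cmod (indicator (E q) f * p q f))\<^sup>2)"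
        by (subst single) (auto simp: off)
      finally show ?thesis .
    qed
    have "(\<Sum>q\<in>Q. \<Sum>\<^sub>\<infinity>k. (cmod (c q k))\<^sup>2) \<le> (\<Sum>q\<in>Q. LINT f|period. (cmod (indicator (E q) f * p q f))\<^sup>2)"
      unfolding c_def by (intro sum_mono bessel bm)
    also have "\<dots> = (LINT f|period. (\<Sum>i\<in>UNIV. (cmod (g i f))\<^sup>2))"
      unfolding pointwise
      by (intro Bochner_Integration.integral_sum[symmetric] integrable_bounded_measurable bm)
    also have "\<dots> = (\<Sum>i\<in>UNIV. (LINT f|period. (cmod (g i f))\<^sup>2))"
      by (intro Bochner_Integration.integral_sum integrable_bounded_measurable g_bm)
    \<comment> \<open>Passing back from the spectrum to time needs Parseval's identity, since
      Bessel's inequality points the other way; this is why \<open>g\<close> had to be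
      approximable.\<close>
    also have "\<dots> = (\<Sum>\<^sub>\<infinity>k. \<Sum>i\<in>UNIV. (cmod (fourier_coeff (g i) k))\<^sup>2)"
      by (simp add: parseval[OF g_approx] infsum_finite_sum fourier_coeff_square_summable[OF g_bm])
    finally have "\<delta> * (\<Sum>q\<in>Q. \<Sum>\<^sub>\<infinity>k. (cmod (c q k))\<^sup>2)
        \<le> (\<Sum>\<^sub>\<infinity>k. \<delta> * (\<Sum>i\<in>UNIV. (cmod (fourier_coeff (g i) k))\<^sup>2))"
      using \<delta>(1) by (simp add: infsum_cmult_right')
    also have "\<dots> \<le> (\<Sum>\<^sub>\<infinity>k. \<Sum>v\<in>S'G. (cmod (X v k))\<^sup>2)"
    proof (rule infsum_mono)
      show "(\<lambda>k. \<delta> * (\<Sum>i\<in>UNIV. (cmod (fourier_coeff (g i) k))\<^sup>2)) summable_on UNIV"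
        by (intro summable_on_cmult_right infsum_finite_sum fourier_coeff_square_summable g_bm)
      show "(\<lambda>k. \<Sum>v\<in>S'G. (cmod (X v k))\<^sup>2) summable_on UNIV"
        by (intro infsum_finite_sum X_sum)
      fix k
      have "g i = (\<lambda>f. 0)" if "F i = {}" for i using g_supp that by auto
      then have "fourier_coeff (g i) k = 0" if "F i = {}" for i
        using that by (simp add: fourier_coeff_def)
      then show "\<delta> * (\<Sum>i\<in>UNIV. (cmod (fourier_coeff (g i) k))\<^sup>2) \<le> (\<Sum>v\<in>S'G. (cmod (X v k))\<^sup>2)"
        unfolding X_def by (rule \<delta>(2))
    qed
    also have "\<dots> = sq_norm_on S'G X"
      unfolding sq_norm_on_def by (intro infsum_finite_sum X_sum)
    finally have norm_le: "\<delta> * (\<Sum>q\<in>Q. \<Sum>\<^sub>\<infinity>k. (cmod (c q k))\<^sup>2) \<le> sq_norm_on S'G X" .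
    \<comment> \<open>The kernel condition makes every channel vanish on the complement of \<Theta>
      in \<open>S'G\<close>, so the full sample energy of \<open>X\<close> sits in
      \<open>T\<close>.\<close>
    have "X v k = 0" if "v \<in> S'G - \<Theta>" for v k
    proof -
      have "M v q = 0" if "q \<in> Q" for q
        using Q_kernel[OF that, of _ v] \<open>v \<in> S'G - \<Theta>\<close> by (simp add: M_def)
      then show ?thesis unfolding X_c by simp
    qed
    then have "v \<in> \<Theta>" if "(v, k) \<in> S" "X v k \<noteq> 0" for v k using that S_sub by blast
    then have energy: "sample_energy S X = (\<Sum>\<^sub>\<infinity>(v, k)\<in>T. (cmod (X v k))\<^sup>2)"
      unfolding sample_energy_def T_def by (intro infsum_cong_neutral) auto
    have "\<delta> * a * (\<Sum>q\<in>Q. \<Sum>\<^sub>\<infinity>k. (cmod (c q k))\<^sup>2) = a * (\<delta> * (\<Sum>q\<in>Q. \<Sum>\<^sub>\<infinity>k. (cmod (c q k))\<^sup>2))"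
      by simp
    also have "\<dots> \<le> a * sq_norm_on S'G X"
      using norm_le a(1) by (intro mult_left_mono) auto
    also have "\<dots> \<le> (\<Sum>\<^sub>\<infinity>(v, k)\<in>T. (cmod (X v k))\<^sup>2)"
      unfolding energy[symmetric] by (rule a(2)[OF \<open>X \<in> BL_D U F\<close>])
    finally have "\<delta> * a * (\<Sum>q\<in>Q. \<Sum>\<^sub>\<infinity>k. (cmod (c q k))\<^sup>2) \<le> (\<Sum>\<^sub>\<infinity>(v, k)\<in>T. (cmod (X v k))\<^sup>2)" .
    then show "(\<Sum>q\<in>Q. \<Sum>\<^sub>\<infinity>k. (cmod (fourier_coeff (\<lambda>f. indicator (E q) f * p q f) k))\<^sup>2)
      \<le> 1 / (\<delta> * a) * (\<Sum>\<^sub>\<infinity>(v, k)\<in>T. (cmod (\<Sum>q\<in>Q. M v q * fourier_coeff (\<lambda>f. indicator (E q) f * p q f) k))\<^sup>2)"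
      using \<delta>(1) a(1) unfolding X_c c_def by (simp add: field_simps)
  qed
  then have "ereal ((\<Sum>i\<in>UNIV. measure lebesgue (F i)) - integral (\<Union>i. F i) (\<lambda>f. real (r {i. f \<in> F i})))
    \<le> liminf (\<lambda>n::nat. ereal (real (card (T \<inter> (UNIV \<times> {-int n..int n}))) / (2 * real n)))" (is "ereal ?d \<le> ?L")
    unfolding density deficit .
  then have "ereal (1 / real (card \<Theta>)) * ereal ?d \<le> ereal (1 / real (card \<Theta>)) * ?L"
    by (intro ereal_mult_left_mono) auto
  also have "\<dots> = liminf (\<lambda>n::nat. ereal (1 / real (card \<Theta>)) * ereal (real (card (T \<inter> (UNIV \<times> {-int n..int n}))) / (2 * real n)))"
    by (intro Liminf_ereal_mult_left[symmetric]) auto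
  also have "\<dots> = sampling_ratio T \<Theta>"
  proof -
    have "T \<inter> (\<Theta> \<times> K) = T \<inter> (UNIV \<times> K)" for K by (auto simp: T_def)
    then show ?thesis by (simp add: sampling_ratio_def mult.commute)
  qed
  finally show ?thesis by (simp add: T_def r_def)
qed

end
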